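(* Let $\mathcal{A}$ be a Banach algebra with a bounded approximate identity, let $\sigma\in Hom(\mathcal{A})$, and suppose that $\mathcal{A}$ is $\sigma$-biflat. If $\sigma$ has dense range, then $\mathcal{A}$ is amenable, and so $\mathcal{A}$ is $\sigma$-amenable.
   Context: $Hom(\mathcal{A})$ is the set of all continuous algebra homomorphisms $\mathcal{A}\to\mathcal{A}$. The projective tensor product $\mathcal{A}\widehat{\otimes}\mathcal{A}$ is a Banach $\mathcal{A}$-bimodule via $a\cdot(b\otimes c)=ab\otimes c$ and $(b\otimes c)\cdot a=b\otimes ca$. The diagonal operator is $\pi:\mathcal{A}\widehat{\otimes}\mathcal{A}\to\mathcal{A}$, $\pi(a\otimes b)=ab$. For a Banach $\mathcal{A}$-bimodule $X$, the dual $X^*$ is a Banach $\mathcal{A}$-bimodule via $\langle a\cdot\lambda,x\rangle=\langle\lambda,x\cdot a\rangle$ and $\langle\lambda\cdot a,x\rangle=\langle\lambda,a\cdot x\rangle$. $\mathcal{A}$ is $\sigma$-biflat if there exists a bounded linear map $\rho:(\mathcal{A}\widehat{\otimes}\mathcal{A})^*\to\mathcal{A}^*$ such that $\rho(\sigma(a)\cdot\lambda)=a\cdot\rho(\lambda)$ and $\rho(\lambda\cdot\sigma(a))=\rho(\lambda)\cdot a$ for all $a\in\mathcal{A}$, $\lambda\in(\mathcal{A}\widehat{\otimes}\mathcal{A})^*$, and $\rho\circ\pi^*=\sigma^*$. For a Banach $\mathcal{A}$-bimodule $X$, a bounded linear map $D:\mathcal{A}\to X$ is a $\sigma$-derivation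 if $D(ab)=\sigma(a)\cdot D(b)+D(a)\cdot\sigma(b)$ for all $a,b\in\mathcal{A}$; it is $\sigma$-inner if there is $x\in X$ with $D(a)=\sigma(a)\cdot x-x\cdot\sigma(a)$ for all $a\in\mathcal{A}$. $\mathcal{A}$ is $\sigma$-amenable if for every Banach $\mathcal{A}$-bimodule $X$, every $\sigma$-derivation $D:\mathcal{A}\to X^*$ is $\sigma$-inner. Amenable is the usual notion, i.e. the case where $\sigma$ is the identity. *)

theory Defs
  imports "HOL-Analysis.Analysis"
begin

section \<open>Complex normed spaces and Banach algebras\<close>

text \<open>The library's normed spaces have real scalars; complex scalars are added on top of them.
  Banach algebras are not assumed to be unital.\<close>

class scaleC =
  fixes scaleC :: "complex \<Rightarrow> 'a \<Rightarrow> 'a" (infixr "*\<^sub>C" 75)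

class complex_normed_vector = real_normed_vector + scaleC +
  assumes scaleC_add_right: "c *\<^sub>C (x + y) = c *\<^sub>C x + c *\<^sub>C y"
    and scaleC_add_left: "(c + d) *\<^sub>C x = c *\<^sub>C x + d *\<^sub>C x"
    and scaleC_scaleC: "c *\<^sub>C d *\<^sub>C x = (c * d) *\<^sub>C x"
    and scaleR_scaleC: "r *\<^sub>R x = complex_of_real r *\<^sub>C x"
    and norm_scaleC: "norm (c *\<^sub>C x) = cmod c * norm x"

class complex_banach = complex_normed_vector + banach

class complex_normed_algebra = real_normed_algebra + complex_normed_vector +
  assumes mult_scaleC_left: "(c *\<^sub>C x) * y = c *\<^sub>C (x * y)"
    and mult_scaleC_right: "x * (c *\<^sub>C y) = c *\<^sub>C (x * y)"

class complex_banach_algebra = complex_normed_algebra + complex_banach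

lemma scaleC_one: "1 *\<^sub>C (x::'a::complex_normed_vector) = x"
  using scaleR_scaleC[of 1 x] by simp

lemma scaleC_minus_one: "(-1) *\<^sub>C (x::'a::complex_normed_vector) = - x"
  using scaleR_scaleC[of "-1" x] by simp

lemma scaleC_zero_left: "0 *\<^sub>C (x::'a::complex_normed_vector) = 0"
  using scaleR_scaleC[of 0 x] by simp

lemma scaleC_zero_right: "c *\<^sub>C (0::'a::complex_normed_vector) = 0"
  using norm_scaleC[of c "0::'a"] by simp

lemma scaleC_minus_right: "c *\<^sub>C (- x) = - (c *\<^sub>C (x::'a::complex_normed_vector))"
  by (metis scaleC_minus_one scaleC_scaleC mult.commute)

lemma scaleC_diff_right: "c *\<^sub>C (x - y) = c *\<^sub>C x - c *\<^sub>C (y::'a::complex_normed_vector)"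
  using scaleC_add_right[of c x "- y"] by (simp add: scaleC_minus_right)

lemma bounded_linear_scaleC: "bounded_linear (\<lambda>x::'a::complex_normed_vector. c *\<^sub>C x)"
proof (rule bounded_linear_intro)
  show "c *\<^sub>C (r *\<^sub>R x) = r *\<^sub>R (c *\<^sub>C x)" for r and x :: 'a
    by (simp add: scaleR_scaleC scaleC_scaleC mult.commute)
  show "norm (c *\<^sub>C x) \<le> norm x * cmod c" for x :: 'a
    by (simp add: norm_scaleC mult.commute)
qed (simp add: scaleC_add_right)

instantiation complex :: complex_banach
begin
definition scaleC_complex :: "complex \<Rightarrow> complex \<Rightarrow> complex"
  where "scaleC_complex c z = c * z"
instance
  by standard (auto simp: scaleC_complex_def algebra_simps norm_mult scaleR_conv_of_real)
end

definition bounded_clinear :: "('a::complex_normed_vector \<Rightarrow> 'b::complex_normed_vector) \<Rightarrow> bool"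
  where "bounded_clinear f \<longleftrightarrow> bounded_linear f \<and> (\<forall>c x. f (c *\<^sub>C x) = c *\<^sub>C f x)"

definition bounded_cbilinear ::
    "('a::complex_normed_vector \<Rightarrow> 'b::complex_normed_vector \<Rightarrow> 'c::complex_normed_vector) \<Rightarrow> bool"
  where "bounded_cbilinear f \<longleftrightarrow> bounded_bilinear f \<and>
    (\<forall>c x y. f (c *\<^sub>C x) y = c *\<^sub>C f x y) \<and> (\<forall>c x y. f x (c *\<^sub>C y) = c *\<^sub>C f x y)"

lemma bounded_cbilinear_mult:
  "bounded_cbilinear (\<lambda>a b :: 'a::complex_normed_algebra. a * b)"
  by (simp add: bounded_cbilinear_def bounded_bilinear_mult mult_scaleC_left mult_scaleC_right)


section \<open>The dual space\<close>

typedef (overloaded) 'a cdual =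
  "{f :: 'a::complex_normed_vector \<Rightarrow>\<^sub>L complex. \<forall>c x. blinfun_apply f (c *\<^sub>C x) = c * blinfun_apply f x}"
  morphisms blinfun_of_cdual cdual_of_blinfun
  by (rule exI[of _ 0]) simp

setup_lifting type_definition_cdual

lift_definition cdual_apply :: "'a::complex_normed_vector cdual \<Rightarrow> 'a \<Rightarrow> complex"
  is blinfun_apply .

definition cdual_of :: "('a::complex_normed_vector \<Rightarrow> complex) \<Rightarrow> 'a cdual"
  where "cdual_of f = cdual_of_blinfun (Blinfun f)"

instantiation cdual :: (complex_normed_vector) complex_normed_vector
begin

lift_definition norm_cdual :: "'a cdual \<Rightarrow> real" is norm .
lift_definition zero_cdual :: "'a cdual" is 0 by simp
lift_definition plus_cdual :: "'a cdual \<Rightarrow> 'a cdual \<Rightarrow> 'a cdual" is "\<lambda>f g. f + g"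
  by (simp add: blinfun.add_left algebra_simps)
lift_definition minus_cdual :: "'a cdual \<Rightarrow> 'a cdual \<Rightarrow> 'a cdual" is "\<lambda>f g. f - g"
  by (simp add: blinfun.diff_left algebra_simps)
lift_definition uminus_cdual :: "'a cdual \<Rightarrow> 'a cdual" is "\<lambda>f. - f"
  by (simp add: blinfun.minus_left)
lift_definition scaleR_cdual :: "real \<Rightarrow> 'a cdual \<Rightarrow> 'a cdual" is "\<lambda>r f. r *\<^sub>R f"
  by (simp add: blinfun.scaleR_left scaleR_conv_of_real)
lift_definition scaleC_cdual :: "complex \<Rightarrow> 'a cdual \<Rightarrow> 'a cdual"
  is "\<lambda>c f. blinfun_mult_right c o\<^sub>L f"
  by simp

definition dist_cdual :: "'a cdual \<Rightarrow> 'a cdual \<Rightarrow> real"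
  where "dist_cdual f g = norm (f - g)"
definition sgn_cdual :: "'a cdual \<Rightarrow> 'a cdual"
  where "sgn_cdual f = scaleR (inverse (norm f)) f"
definition uniformity_cdual :: "('a cdual \<times> 'a cdual) filter"
  where "uniformity_cdual = (INF e\<in>{0 <..}. principal {(x, y). dist x y < e})"
definition open_cdual :: "'a cdual set \<Rightarrow> bool"
  where "open_cdual S = (\<forall>x\<in>S. \<forall>\<^sub>F (x', y) in uniformity. x' = x \<longrightarrow> y \<in> S)"

instance
proof
  fix f g h :: "'a cdual" and c d :: complex and r s :: real
  show "f + g + h = f + (g + h)" by transfer simp
  show "f + g = g + f" by transfer simp
  show "0 + f = f" by transfer simp
  show "- f + f = 0" by transfer simp
  show "f - g = f + - g" by transfer simp
  show "r *\<^sub>R (f + g) = r *\<^sub>R f + r *\<^sub>R g" by transfer (simp add: scaleR_add_right)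
  show "(r + s) *\<^sub>R f = r *\<^sub>R f + s *\<^sub>R f" by transfer (simp add: scaleR_add_left)
  show "r *\<^sub>R s *\<^sub>R f = (r * s) *\<^sub>R f" by transfer simp
  show "1 *\<^sub>R f = f" by transfer simp
  show "sgn f = inverse (norm f) *\<^sub>R f" by (simp add: sgn_cdual_def)
  show "dist f g = norm (f - g)" by (rule dist_cdual_def)
  show "(norm f = 0) = (f = 0)" by transfer simp
  show "norm (f + g) \<le> norm f + norm g" by transfer (rule norm_triangle_ineq)
  show "norm (r *\<^sub>R f) = \<bar>r\<bar> * norm f" by transfer simp
  show "c *\<^sub>C (f + g) = c *\<^sub>C f + c *\<^sub>C g"
    by transfer (auto intro!: blinfun_eqI simp: blinfun.add_left algebra_simps)
  show "(c + d) *\<^sub>C f = c *\<^sub>C f + d *\<^sub>C f"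
    by transfer (auto intro!: blinfun_eqI simp: blinfun.add_left algebra_simps)
  show "c *\<^sub>C d *\<^sub>C f = (c * d) *\<^sub>C f"
    by transfer (auto intro!: blinfun_eqI simp: algebra_simps)
  show rC: "r *\<^sub>R f = complex_of_real r *\<^sub>C f" for r and f :: "'a cdual"
    by transfer (auto intro!: blinfun_eqI simp: blinfun.scaleR_left scaleR_conv_of_real)
  have le: "norm (c *\<^sub>C f) \<le> cmod c * norm f" for c and f :: "'a cdual"
  proof transfer
    fix c and f :: "'a \<Rightarrow>\<^sub>L complex"
    show "norm (blinfun_mult_right c o\<^sub>L f) \<le> cmod c * norm f"
    proof (rule norm_blinfun_bound)
      show "norm (blinfun_apply (blinfun_mult_right c o\<^sub>L f) x) \<le> cmod c * norm f * norm x" for x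
        using mult_left_mono[OF norm_blinfun[of f x], of "cmod c"] by (simp add: norm_mult mult.assoc)
    qed simp
  qed
  show "norm (c *\<^sub>C f) = cmod c * norm f"
  proof (cases "c = 0")
    case True
    have "0 \<le> norm (c *\<^sub>C f)" by transfer simp
    with True le[of c f] show ?thesis by simp
  next
    case False
    have "f = inverse c *\<^sub>C c *\<^sub>C f"
      using False by transfer (auto intro!: blinfun_eqI)
    then have "norm f \<le> cmod (inverse c) * norm (c *\<^sub>C f)"
      using le[of "inverse c" "c *\<^sub>C f"] by simp
    then have "cmod c * norm f \<le> norm (c *\<^sub>C f)"
      using False by (simp only: norm_inverse) (simp add: field_simps)
    with le[of c f] show ?thesis by simp
  qed
qed (simp_all add: uniformity_cdual_def open_cdual_def)

end

instance cdual :: (complex_normed_vector) complex_banach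
proof
  fix X :: "nat \<Rightarrow> 'a cdual"
  assume "Cauchy X"
  have nd: "norm (blinfun_of_cdual f - blinfun_of_cdual g) = norm (f - g)" for f g :: "'a cdual"
    by transfer simp
  have "Cauchy (\<lambda>n. blinfun_of_cdual (X n))"
    using \<open>Cauchy X\<close> by (simp add: Cauchy_iff nd)
  then obtain F where F: "(\<lambda>n. blinfun_of_cdual (X n)) \<longlonglongrightarrow> F"
    using Cauchy_convergent convergent_def by blast
  have ev: "(\<lambda>n. blinfun_apply (blinfun_of_cdual (X n)) x) \<longlonglongrightarrow> blinfun_apply F x" for x
    by (rule blinfun.tendsto[OF F tendsto_const])
  have "blinfun_apply F (c *\<^sub>C x) = c * blinfun_apply F x" for c x
  proof (rule LIMSEQ_unique[OF ev])
    have "blinfun_apply (blinfun_of_cdual (X n)) (c *\<^sub>C x) = c * blinfun_apply (blinfun_of_cdual (X n)) x" for n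
      using blinfun_of_cdual by blast
    then show "(\<lambda>n. blinfun_apply (blinfun_of_cdual (X n)) (c *\<^sub>C x)) \<longlonglongrightarrow> c * blinfun_apply F x"
      using tendsto_mult_left[OF ev] by simp
  qed
  then have "blinfun_of_cdual (cdual_of_blinfun F) = F"
    by (simp add: cdual_of_blinfun_inverse)
  then have "X \<longlonglongrightarrow> cdual_of_blinfun F"
    using F nd by (metis (no_types, lifting) LIMSEQ_iff)
  then show "convergent X" by (auto simp: convergent_def)
qed

lemma cdual_eqI: "(\<And>x. cdual_apply f x = cdual_apply g x) \<Longrightarrow> f = g"
  by transfer (auto intro: blinfun_eqI)

lemma bounded_clinear_cdual_apply: "bounded_clinear (cdual_apply f)"
  unfolding bounded_clinear_def scaleC_complex_def
  by transfer (simp add: blinfun.bounded_linear_right)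

lemma cdual_apply_cdual_of: "bounded_clinear f \<Longrightarrow> cdual_apply (cdual_of f) = f"
  unfolding cdual_apply.rep_eq cdual_of_def bounded_clinear_def scaleC_complex_def
  by (simp add: cdual_of_blinfun_inverse bounded_linear_Blinfun_apply)

lemma norm_cdual_onorm: "norm f = onorm (cdual_apply f)"
  by transfer (rule norm_blinfun.rep_eq)

lemma cdual_apply_add: "cdual_apply (f + g) x = cdual_apply f x + cdual_apply g x"
  by transfer (rule blinfun.add_left)

lemma cdual_apply_diff: "cdual_apply (f - g) x = cdual_apply f x - cdual_apply g x"
  by transfer (rule blinfun.diff_left)

lemma cdual_apply_scaleC: "cdual_apply (c *\<^sub>C f) x = c * cdual_apply f x"
  by transfer simp

definition banach_adjoint ::
    "('a::complex_normed_vector \<Rightarrow> 'b::complex_normed_vector) \<Rightarrow> 'b cdual \<Rightarrow> 'a cdual"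
  where "banach_adjoint T f = cdual_of (\<lambda>x. cdual_apply f (T x))"

lemma bounded_clinear_compose:
  "bounded_clinear f \<Longrightarrow> bounded_clinear g \<Longrightarrow> bounded_clinear (\<lambda>x. f (g x))"
  unfolding bounded_clinear_def using bounded_linear_compose by auto

lemma cdual_apply_banach_adjoint:
  "bounded_clinear T \<Longrightarrow> cdual_apply (banach_adjoint T f) x = cdual_apply f (T x)"
  unfolding banach_adjoint_def
  by (simp add: cdual_apply_cdual_of bounded_clinear_compose[OF bounded_clinear_cdual_apply])


section \<open>Completion of a normed space\<close>

definition completion_rel :: "(nat \<Rightarrow> 'a::complex_normed_vector) \<Rightarrow> (nat \<Rightarrow> 'a) \<Rightarrow> bool"
  where "completion_rel u v \<longleftrightarrow> Cauchy u \<and> Cauchy v \<and> (\<lambda>n. u n - v n) \<longlonglongrightarrow> 0"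

quotient_type (overloaded) 'a completion = "nat \<Rightarrow> 'a::complex_normed_vector" / partial: completion_rel
proof (rule part_equivpI)
  show "\<exists>u::nat \<Rightarrow> 'a. completion_rel u u"
    by (rule exI[of _ "\<lambda>_. 0"]) (simp add: completion_rel_def convergent_Cauchy convergent_const)
  show "symp (completion_rel :: (nat \<Rightarrow> 'a) \<Rightarrow> _)"
  proof (rule sympI)
    fix u v :: "nat \<Rightarrow> 'a"
    assume "completion_rel u v"
    then show "completion_rel v u"
      using tendsto_minus[of "\<lambda>n. u n - v n" 0] by (auto simp: completion_rel_def)
  qed
  show "transp (completion_rel :: (nat \<Rightarrow> 'a) \<Rightarrow> _)"
  proof (rule transpI)
    fix u v w :: "nat \<Rightarrow> 'a"
    assume "completion_rel u v" "completion_rel v w"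
    then show "completion_rel u w"
      using tendsto_add[of "\<lambda>n. u n - v n" 0 sequentially "\<lambda>n. v n - w n" 0]
      by (auto simp: completion_rel_def)
  qed
qed

lemma Cauchy_dominated:
  fixes u :: "nat \<Rightarrow> 'a::metric_space" and v :: "nat \<Rightarrow> 'b::metric_space" and w :: "nat \<Rightarrow> 'c::metric_space"
  assumes u: "Cauchy u" and v: "Cauchy v"
    and le: "\<And>m n. dist (w m) (w n) \<le> dist (u m) (u n) + dist (v m) (v n)"
  shows "Cauchy w"
proof (rule metric_CauchyI)
  fix e :: real
  assume "0 < e"
  then have e2: "0 < e / 2" by simp
  obtain M where M: "\<And>m n. M \<le> m \<Longrightarrow> M \<le> n \<Longrightarrow> dist (u m) (u n) < e / 2"
    using metric_CauchyD[OF u e2] by blast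
  obtain N where N: "\<And>m n. N \<le> m \<Longrightarrow> N \<le> n \<Longrightarrow> dist (v m) (v n) < e / 2"
    using metric_CauchyD[OF v e2] by blast
  have "dist (w m) (w n) < e" if "max M N \<le> m" "max M N \<le> n" for m n
    using le[of m n] M[of m n] N[of m n] that by simp
  then show "\<exists>K. \<forall>m\<ge>K. \<forall>n\<ge>K. dist (w m) (w n) < e" by blast
qed

lemma Cauchy_add_seq: "Cauchy u \<Longrightarrow> Cauchy v \<Longrightarrow> Cauchy (\<lambda>n. u n + v n :: 'a::real_normed_vector)"
  by (erule (1) Cauchy_dominated) (simp add: dist_triangle_add)

lemma Cauchy_uminus_seq: "Cauchy u \<Longrightarrow> Cauchy (\<lambda>n. - u n :: 'a::real_normed_vector)"
  by (rule bounded_linear.Cauchy[OF bounded_linear_minus[OF bounded_linear_ident]])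

lemma Cauchy_minus_seq: "Cauchy u \<Longrightarrow> Cauchy v \<Longrightarrow> Cauchy (\<lambda>n. u n - v n :: 'a::real_normed_vector)"
  using Cauchy_add_seq[of u "\<lambda>n. - v n"] Cauchy_uminus_seq[of v] by simp

lemma convergent_norm_Cauchy: "Cauchy u \<Longrightarrow> convergent (\<lambda>n. norm (u n :: 'a::real_normed_vector))"
proof -
  assume "Cauchy u"
  then have "Cauchy (\<lambda>n. norm (u n))"
    by (rule Cauchy_dominated[where v="\<lambda>_. 0::real"])
      (auto simp: dist_norm intro: norm_triangle_ineq3 convergent_Cauchy convergent_const)
  then show ?thesis by (rule Cauchy_convergent)
qed

lemma tendsto_norm_diff:
  fixes u v :: "nat \<Rightarrow> 'a::real_normed_vector"
  assumes "(\<lambda>n. u n - v n) \<longlonglongrightarrow> 0" "(\<lambda>n. norm (u n)) \<longlonglongrightarrow> l"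
  shows "(\<lambda>n. norm (v n)) \<longlonglongrightarrow> l"
proof -
  have "(\<lambda>n. norm (u n) - norm (v n)) \<longlonglongrightarrow> 0"
    by (rule tendsto_0_le[OF assms(1), of _ 1]) (simp add: norm_triangle_ineq3)
  from tendsto_diff[OF assms(2) this] show ?thesis by simp
qed

instantiation completion :: (complex_normed_vector) complex_normed_vector
begin

lift_definition norm_completion :: "'a completion \<Rightarrow> real" is "\<lambda>u. lim (\<lambda>n. norm (u n))"
proof -
  fix u v :: "nat \<Rightarrow> 'a"
  assume uv: "completion_rel u v"
  then obtain l where "(\<lambda>n. norm (u n)) \<longlonglongrightarrow> l"
    unfolding completion_rel_def using convergent_norm_Cauchy convergent_def by blast
  with tendsto_norm_diff uv show "lim (\<lambda>n. norm (u n)) = lim (\<lambda>n. norm (v n))"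
    by (metis limI completion_rel_def)
qed

lift_definition zero_completion :: "'a completion" is "\<lambda>_. 0"
  by (simp add: completion_rel_def convergent_Cauchy convergent_const)

lift_definition plus_completion :: "'a completion \<Rightarrow> 'a completion \<Rightarrow> 'a completion"
  is "\<lambda>u v n. u n + v n"
proof -
  fix u u' v v' :: "nat \<Rightarrow> 'a"
  assume "completion_rel u u'" "completion_rel v v'"
  then show "completion_rel (\<lambda>n. u n + v n) (\<lambda>n. u' n + v' n)"
    using tendsto_add[of "\<lambda>n. u n - u' n" 0 sequentially "\<lambda>n. v n - v' n" 0]
    by (auto simp: completion_rel_def Cauchy_add_seq algebra_simps)
qed

lift_definition uminus_completion :: "'a completion \<Rightarrow> 'a completion" is "\<lambda>u n. - u n"
proof -
  fix u v :: "nat \<Rightarrow> 'a"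
  assume "completion_rel u v"
  then show "completion_rel (\<lambda>n. - u n) (\<lambda>n. - v n)"
    using tendsto_minus[of "\<lambda>n. u n - v n" 0] by (auto simp: completion_rel_def Cauchy_uminus_seq)
qed

lift_definition minus_completion :: "'a completion \<Rightarrow> 'a completion \<Rightarrow> 'a completion"
  is "\<lambda>u v n. u n - v n"
proof -
  fix u u' v v' :: "nat \<Rightarrow> 'a"
  assume "completion_rel u u'" "completion_rel v v'"
  then show "completion_rel (\<lambda>n. u n - v n) (\<lambda>n. u' n - v' n)"
    using tendsto_diff[of "\<lambda>n. u n - u' n" 0 sequentially "\<lambda>n. v n - v' n" 0]
    by (auto simp: completion_rel_def Cauchy_minus_seq algebra_simps)
qed

lift_definition scaleR_completion :: "real \<Rightarrow> 'a completion \<Rightarrow> 'a completion"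
  is "\<lambda>r u n. r *\<^sub>R u n"
proof -
  fix r and u v :: "nat \<Rightarrow> 'a"
  assume "completion_rel u v"
  then show "completion_rel (\<lambda>n. r *\<^sub>R u n) (\<lambda>n. r *\<^sub>R v n)"
    using bounded_linear.Cauchy[OF bounded_linear_scaleR_right[of r]]
      bounded_linear.tendsto[OF bounded_linear_scaleR_right[of r], of "\<lambda>n. u n - v n" 0]
    by (auto simp: completion_rel_def scaleR_diff_right)
qed

lift_definition scaleC_completion :: "complex \<Rightarrow> 'a completion \<Rightarrow> 'a completion"
  is "\<lambda>c u n. c *\<^sub>C u n"
proof -
  fix c and u v :: "nat \<Rightarrow> 'a"
  assume "completion_rel u v"
  then show "completion_rel (\<lambda>n. c *\<^sub>C u n) (\<lambda>n. c *\<^sub>C v n)"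
    using bounded_linear.Cauchy[OF bounded_linear_scaleC[of c]]
      bounded_linear.tendsto[OF bounded_linear_scaleC[of c], of "\<lambda>n. u n - v n" 0]
    by (auto simp: completion_rel_def scaleC_diff_right scaleC_zero_right)
qed

definition dist_completion :: "'a completion \<Rightarrow> 'a completion \<Rightarrow> real"
  where "dist_completion x y = norm (x - y)"
definition sgn_completion :: "'a completion \<Rightarrow> 'a completion"
  where "sgn_completion x = scaleR (inverse (norm x)) x"
definition uniformity_completion :: "('a completion \<times> 'a completion) filter"
  where "uniformity_completion = (INF e\<in>{0 <..}. principal {(x, y). dist x y < e})"
definition open_completion :: "'a completion set \<Rightarrow> bool"
  where "open_completion S = (\<forall>x\<in>S. \<forall>\<^sub>F (x', y) in uniformity. x' = x \<longrightarrow> y \<in> S)"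

instance
proof
  have refl_rel: "completion_rel u u" if "Cauchy u" for u :: "nat \<Rightarrow> 'a"
    using that by (simp add: completion_rel_def)
  have cauchy: "Cauchy u" if "completion_rel u u" for u :: "nat \<Rightarrow> 'a"
    using that by (simp add: completion_rel_def)
  note C = Cauchy_add_seq Cauchy_uminus_seq Cauchy_minus_seq
    bounded_linear.Cauchy[OF bounded_linear_scaleC] bounded_linear.Cauchy[OF bounded_linear_scaleR_right]
  fix x y z :: "'a completion" and c d :: complex and r s :: real
  show "x + y + z = x + (y + z)"
    by transfer (auto simp: add.assoc dest!: cauchy intro!: refl_rel C)
  show "x + y = y + x"
    by transfer (auto simp: add.commute dest!: cauchy intro!: refl_rel C)
  show "0 + x = x"
    by transfer (auto dest!: cauchy intro!: refl_rel C)
  show "- x + x = 0"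
    by transfer (auto intro!: refl_rel convergent_Cauchy convergent_const)
  show "x - y = x + - y"
    by transfer (auto dest!: cauchy intro!: refl_rel C)
  show "r *\<^sub>R (x + y) = r *\<^sub>R x + r *\<^sub>R y"
    by transfer (auto simp: scaleR_add_right dest!: cauchy intro!: refl_rel C)
  show "(r + s) *\<^sub>R x = r *\<^sub>R x + s *\<^sub>R x"
    by transfer (auto simp: scaleR_add_left dest!: cauchy intro!: refl_rel C)
  show "r *\<^sub>R s *\<^sub>R x = (r * s) *\<^sub>R x"
    by transfer (auto dest!: cauchy intro!: refl_rel C)
  show "1 *\<^sub>R x = x"
    by transfer (auto dest!: cauchy intro!: refl_rel C)
  show "sgn x = inverse (norm x) *\<^sub>R x" by (simp add: sgn_completion_def)
  show "dist x y = norm (x - y)" by (rule dist_completion_def)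
  show "c *\<^sub>C (x + y) = c *\<^sub>C x + c *\<^sub>C y"
    by transfer (auto simp: scaleC_add_right dest!: cauchy intro!: refl_rel C)
  show "(c + d) *\<^sub>C x = c *\<^sub>C x + d *\<^sub>C x"
    by transfer (auto simp: scaleC_add_left dest!: cauchy intro!: refl_rel C)
  show "c *\<^sub>C d *\<^sub>C x = (c * d) *\<^sub>C x"
    by transfer (auto simp: scaleC_scaleC dest!: cauchy intro!: refl_rel C)
  show "r *\<^sub>R x = complex_of_real r *\<^sub>C x"
    by transfer (auto simp: scaleR_scaleC[symmetric] dest!: cauchy intro!: refl_rel C)
  have lim_norm: "(\<lambda>n. norm (u n)) \<longlonglongrightarrow> lim (\<lambda>n. norm (u n))" if "completion_rel u u" for u :: "nat \<Rightarrow> 'a"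
    using convergent_norm_Cauchy[OF cauchy[OF that]] by (simp add: convergent_LIMSEQ_iff)
  show "(norm x = 0) = (x = 0)"
  proof transfer
    fix u :: "nat \<Rightarrow> 'a"
    assume u: "completion_rel u u"
    show "(lim (\<lambda>n. norm (u n)) = 0) = completion_rel u (\<lambda>_. 0)"
    proof
      assume "lim (\<lambda>n. norm (u n)) = 0"
      with lim_norm[OF u] have "u \<longlonglongrightarrow> 0" using tendsto_norm_zero_iff by force
      with cauchy[OF u] show "completion_rel u (\<lambda>_. 0)"
        by (simp add: completion_rel_def convergent_Cauchy convergent_const)
    next
      assume "completion_rel u (\<lambda>_. 0)"
      then have "u \<longlonglongrightarrow> 0" by (simp add: completion_rel_def)
      then show "lim (\<lambda>n. norm (u n)) = 0" using tendsto_norm_zero limI by blast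
    qed
  qed
  show "norm (x + y) \<le> norm x + norm y"
  proof transfer
    fix u v :: "nat \<Rightarrow> 'a"
    assume u: "completion_rel u u" and v: "completion_rel v v"
    have uv: "completion_rel (\<lambda>n. u n + v n) (\<lambda>n. u n + v n)"
      by (rule refl_rel[OF Cauchy_add_seq[OF cauchy[OF u] cauchy[OF v]]])
    show "lim (\<lambda>n. norm (u n + v n)) \<le> lim (\<lambda>n. norm (u n)) + lim (\<lambda>n. norm (v n))"
      by (rule LIMSEQ_le[OF lim_norm[OF uv] tendsto_add[OF lim_norm[OF u] lim_norm[OF v]]])
        (auto intro: norm_triangle_ineq)
  qed
  show "norm (r *\<^sub>R x) = \<bar>r\<bar> * norm x"
    by transfer (auto intro!: limI tendsto_mult_left lim_norm)
  show "norm (c *\<^sub>C x) = cmod c * norm x"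
    by transfer (auto simp: norm_scaleC intro!: limI tendsto_mult_left lim_norm)
qed (simp_all add: uniformity_completion_def open_completion_def)

end

lift_definition completion_embed :: "'a::complex_normed_vector \<Rightarrow> 'a completion" is "\<lambda>x _. x"
  by (simp add: completion_rel_def convergent_Cauchy convergent_const)

lemma norm_completion_embed: "norm (completion_embed x) = norm x"
  by transfer simp

lemma completion_embed_add: "completion_embed (x + y) = completion_embed x + completion_embed y"
  by transfer (simp add: completion_rel_def convergent_Cauchy convergent_const)

lemma completion_embed_diff: "completion_embed (x - y) = completion_embed x - completion_embed y"
  by transfer (simp add: completion_rel_def convergent_Cauchy convergent_const)

lemma completion_embed_scaleC: "completion_embed (c *\<^sub>C x) = c *\<^sub>C completion_embed x"
  by transfer (simp add: completion_rel_def convergent_Cauchy convergent_const)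

lemma abs_completion_limit:
  assumes u: "Cauchy u"
  shows "(\<lambda>n. completion_embed (u n)) \<longlonglongrightarrow> abs_completion u"
proof (rule metric_LIMSEQ_I)
  fix e :: real
  assume "0 < e"
  then have e2: "0 < e / 2" by simp
  obtain M where M: "\<And>m n. M \<le> m \<Longrightarrow> M \<le> n \<Longrightarrow> norm (u m - u n) < e / 2"
    using CauchyD[OF u e2] by blast
  have "dist (completion_embed (u n)) (abs_completion u) < e" if "M \<le> n" for n
  proof -
    have k: "Cauchy (\<lambda>m. u n)" by (simp add: convergent_Cauchy convergent_const)
    have d: "Cauchy (\<lambda>m. u n - u m)" by (rule Cauchy_minus_seq[OF k u])
    have "completion_embed (u n) - abs_completion u = abs_completion (\<lambda>m. u n - u m)"
      using u k by (simp add: completion_embed.abs_eq minus_completion.abs_eq completion_rel_def eq_onp_def)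
    then have "norm (completion_embed (u n) - abs_completion u) = lim (\<lambda>m. norm (u n - u m))"
      using d by (simp add: norm_completion.abs_eq completion_rel_def)
    also have "\<dots> \<le> e / 2"
    proof (rule LIMSEQ_le_const2)
      show "(\<lambda>m. norm (u n - u m)) \<longlonglongrightarrow> lim (\<lambda>m. norm (u n - u m))"
        using convergent_norm_Cauchy[OF d] by (simp add: convergent_LIMSEQ_iff)
      show "\<exists>N. \<forall>m\<ge>N. norm (u n - u m) \<le> e / 2"
        using M[OF that] by (meson less_imp_le)
    qed
    finally show ?thesis using \<open>0 < e\<close> by (simp add: dist_norm)
  qed
  then show "\<exists>N. \<forall>n\<ge>N. dist (completion_embed (u n)) (abs_completion u) < e" by blast
qed

lemma rep_completion_Cauchy: "Cauchy (rep_completion x)"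
  using Quotient3_rep_reflp[OF Quotient3_completion, of x] by (simp add: completion_rel_def)

lemma rep_completion_limit: "(\<lambda>n. completion_embed (rep_completion x n)) \<longlonglongrightarrow> x"
  using abs_completion_limit[OF rep_completion_Cauchy[of x]]
  by (simp add: Quotient3_abs_rep[OF Quotient3_completion])

instance completion :: (complex_normed_vector) complex_banach
proof
  fix Z :: "nat \<Rightarrow> 'a completion"
  assume Z: "Cauchy Z"
  have "\<exists>v. norm (Z n - completion_embed v) < inverse (real (Suc n))" for n
    using metric_LIMSEQ_D[OF rep_completion_limit[of "Z n"], of "inverse (real (Suc n))"]
    by (metis dist_norm dist_commute inverse_positive_iff_positive le_refl of_nat_0_less_iff zero_less_Suc)
  then obtain v where v: "\<And>n. norm (Z n - completion_embed (v n)) < inverse (real (Suc n))"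
    by metis
  have d0: "(\<lambda>n. Z n - completion_embed (v n)) \<longlonglongrightarrow> 0"
    by (rule tendsto_0_le[OF LIMSEQ_inverse_real_of_nat, of _ 1])
      (use v[THEN less_imp_le] in simp)
  have "Cauchy (\<lambda>n. Z n - (Z n - completion_embed (v n)))"
    by (rule Cauchy_minus_seq[OF Z LIMSEQ_imp_Cauchy[OF d0]])
  then have "Cauchy v"
    by (simp add: Cauchy_iff completion_embed_diff[symmetric] norm_completion_embed)
  from tendsto_add[OF d0 abs_completion_limit[OF this]] show "convergent Z"
    by (auto simp: convergent_def)
qed

text \<open>The continuous extension of a bounded linear map to the completion.\<close>

definition completion_extend ::
    "('a::complex_normed_vector \<Rightarrow> 'b::complex_banach) \<Rightarrow> 'a completion \<Rightarrow> 'b"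
  where "completion_extend f x = lim (\<lambda>n. f (rep_completion x n))"

lemma completion_extend_limit:
  assumes f: "bounded_linear f" and u: "Cauchy u"
    and lim: "(\<lambda>n. completion_embed (u n)) \<longlonglongrightarrow> x"
  shows "(\<lambda>n. f (u n)) \<longlonglongrightarrow> completion_extend f x"
proof -
  interpret f: bounded_linear f by fact
  let ?r = "rep_completion x"
  have "(\<lambda>n. f (?r n)) \<longlonglongrightarrow> completion_extend f x"
    unfolding completion_extend_def
    using f.Cauchy[OF rep_completion_Cauchy[of x]]
    by (simp add: Cauchy_convergent convergent_LIMSEQ_iff[symmetric])
  moreover have "(\<lambda>n. u n - ?r n) \<longlonglongrightarrow> 0"
  proof -
    have "(\<lambda>n. completion_embed (u n) - completion_embed (?r n)) \<longlonglongrightarrow> 0"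
      using tendsto_diff[OF lim rep_completion_limit[of x]] by simp
    then show ?thesis
      by (simp add: completion_embed_diff[symmetric] tendsto_norm_zero_iff[symmetric, where 'b='a]
          tendsto_norm_zero_iff[symmetric, where 'b="'a completion"] norm_completion_embed)
  qed
  ultimately show ?thesis
    using tendsto_add[OF f.tendsto[of "\<lambda>n. u n - ?r n" 0 sequentially]]
    by (fastforce simp: f.diff f.zero)
qed

lemma completion_extend_embed:
  assumes "bounded_linear f"
  shows "completion_extend f (completion_embed x) = f x"
  using completion_extend_limit[OF assms, of "\<lambda>_. x" "completion_embed x"]
  by (simp add: convergent_Cauchy convergent_const LIMSEQ_const_iff)

lemma bounded_clinear_completion_extend:
  assumes f: "bounded_clinear f"
  shows "bounded_clinear (completion_extend f)"
proof -
  have bl: "bounded_linear f" and fC: "f (c *\<^sub>C x) = c *\<^sub>C f x" for c x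
    using f by (auto simp: bounded_clinear_def)
  interpret f: bounded_linear f by fact
  note L = completion_extend_limit[OF bl rep_completion_Cauchy rep_completion_limit]
  have add: "completion_extend f (x + y) = completion_extend f x + completion_extend f y" for x y
  proof -
    have "(\<lambda>n. f (rep_completion x n + rep_completion y n)) \<longlonglongrightarrow> completion_extend f (x + y)"
      by (rule completion_extend_limit[OF bl Cauchy_add_seq[OF rep_completion_Cauchy rep_completion_Cauchy]])
        (simp add: completion_embed_add tendsto_add[OF rep_completion_limit rep_completion_limit])
    moreover have "(\<lambda>n. f (rep_completion x n + rep_completion y n)) \<longlonglongrightarrow> completion_extend f x + completion_extend f y"
      by (simp add: f.add tendsto_add[OF L L])
    ultimately show ?thesis by (rule LIMSEQ_unique)
  qed
  have sc: "completion_extend f (c *\<^sub>C x) = c *\<^sub>C completion_extend f x" for c x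
  proof -
    have "(\<lambda>n. f (c *\<^sub>C rep_completion x n)) \<longlonglongrightarrow> completion_extend f (c *\<^sub>C x)"
      by (rule completion_extend_limit[OF bl bounded_linear.Cauchy[OF bounded_linear_scaleC rep_completion_Cauchy]])
        (simp add: completion_embed_scaleC bounded_linear.tendsto[OF bounded_linear_scaleC rep_completion_limit])
    moreover have "(\<lambda>n. f (c *\<^sub>C rep_completion x n)) \<longlonglongrightarrow> c *\<^sub>C completion_extend f x"
      by (simp add: fC bounded_linear.tendsto[OF bounded_linear_scaleC L])
    ultimately show ?thesis by (rule LIMSEQ_unique)
  qed
  obtain K where K: "\<And>x. norm (f x) \<le> norm x * K" using f.bounded by blast
  have bound: "norm (completion_extend f x) \<le> norm x * K" for x
  proof (rule LIMSEQ_le)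
    show "(\<lambda>n. norm (f (rep_completion x n))) \<longlonglongrightarrow> norm (completion_extend f x)"
      by (rule tendsto_norm[OF L])
    show "(\<lambda>n. norm (rep_completion x n) * K) \<longlonglongrightarrow> norm x * K"
      using tendsto_mult_right[OF tendsto_norm[OF rep_completion_limit[of x]], of K]
      by (simp add: norm_completion_embed)
  qed (use K in auto)
  have "bounded_linear (completion_extend f)"
    by (rule bounded_linear_intro[OF add _ bound]) (simp add: scaleR_scaleC sc)
  with sc show ?thesis by (simp add: bounded_clinear_def)
qed

lemma bounded_clinear_completion_unique:
  assumes f: "bounded_clinear f" and g: "bounded_clinear g"
    and eq: "\<And>x. f (completion_embed x) = g (completion_embed x)"
  shows "f = g"
proof
  fix x
  have "(\<lambda>n. f (completion_embed (rep_completion x n))) \<longlonglongrightarrow> f x"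
    "(\<lambda>n. g (completion_embed (rep_completion x n))) \<longlonglongrightarrow> g x"
    using f g bounded_linear.tendsto[OF _ rep_completion_limit] by (auto simp: bounded_clinear_def)
  then show "f x = g x" using eq LIMSEQ_unique by simp
qed


section \<open>The projective tensor product\<close>

text \<open>A list \<^term>\<open>[(a1, b1), (a2, b2)]\<close> stands for the formal sum of the elementary tensors
  of its entries. The following congruence identifies two formal sums iff they
  denote the same element of the algebraic tensor product over the complex numbers.\<close>

inductive tensor_eq ::
    "('a::complex_normed_vector \<times> 'b::complex_normed_vector) list \<Rightarrow> ('a \<times> 'b) list \<Rightarrow> bool"
  where
    refl: "tensor_eq xs xs"
  | sym: "tensor_eq xs ys \<Longrightarrow> tensor_eq ys xs"
  | trans: "tensor_eq xs ys \<Longrightarrow> tensor_eq ys zs \<Longrightarrow> tensor_eq xs zs"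
  | append: "tensor_eq xs xs' \<Longrightarrow> tensor_eq ys ys' \<Longrightarrow> tensor_eq (xs @ ys) (xs' @ ys')"
  | commute: "tensor_eq (xs @ ys) (ys @ xs)"
  | zero: "tensor_eq [(0, b)] []"
  | add_left: "tensor_eq [(a + a', b)] [(a, b), (a', b)]"
  | add_right: "tensor_eq [(a, b + b')] [(a, b), (a, b')]"
  | scale: "tensor_eq [(c *\<^sub>C a, b)] [(a, c *\<^sub>C b)]"

definition fsum_scale ::
    "complex \<Rightarrow> ('a::complex_normed_vector \<times> 'b::complex_normed_vector) list \<Rightarrow> ('a \<times> 'b) list"
  where "fsum_scale c xs = map (\<lambda>(a, b). (c *\<^sub>C a, b)) xs"

definition fsum_norm :: "('a::complex_normed_vector \<times> 'b::complex_normed_vector) list \<Rightarrow> real"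
  where "fsum_norm xs = (\<Sum>(a, b)\<leftarrow>xs. norm a * norm b)"

definition projective_norm :: "('a::complex_normed_vector \<times> 'b::complex_normed_vector) list \<Rightarrow> real"
  where "projective_norm xs = Inf {fsum_norm ys |ys. tensor_eq ys xs}"

lemma fsum_scale_simps [simp]:
  "fsum_scale c [] = []"
  "fsum_scale c ((a, b) # xs) = (c *\<^sub>C a, b) # fsum_scale c xs"
  "fsum_scale c (xs @ ys) = fsum_scale c xs @ fsum_scale c ys"
  by (simp_all add: fsum_scale_def)

lemma fsum_norm_simps [simp]:
  "fsum_norm [] = 0"
  "fsum_norm ((a, b) # xs) = norm a * norm b + fsum_norm xs"
  "fsum_norm (xs @ ys) = fsum_norm xs + fsum_norm ys"
  by (simp_all add: fsum_norm_def)

lemma fsum_norm_scale: "fsum_norm (fsum_scale c xs) = cmod c * fsum_norm xs"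
  by (induction xs) (auto simp: norm_scaleC algebra_simps)

lemma fsum_norm_nonneg: "0 \<le> fsum_norm xs"
  by (induction xs) auto

lemma tensor_eq_Cons: "tensor_eq xs ys \<Longrightarrow> tensor_eq (p # xs) (p # ys)"
  using tensor_eq.append[OF tensor_eq.refl[of "[p]"], of xs ys] by simp

lemma tensor_eq_append_left: "tensor_eq ys zs \<Longrightarrow> tensor_eq (xs @ ys) (xs @ zs)"
  by (rule tensor_eq.append[OF tensor_eq.refl])

lemma tensor_eq_fsum_scale: "tensor_eq xs ys \<Longrightarrow> tensor_eq (fsum_scale c xs) (fsum_scale c ys)"
proof (induction rule: tensor_eq.induct)
  case (sym xs ys)
  then show ?case by (blast intro: tensor_eq.sym)
next
  case (trans xs ys zs)
  then show ?case by (blast intro: tensor_eq.trans)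
next
  case (scale d a b)
  have "c *\<^sub>C d *\<^sub>C a = d *\<^sub>C c *\<^sub>C a" by (simp add: scaleC_scaleC mult.commute)
  then show ?case using tensor_eq.scale[of d "c *\<^sub>C a" b] by simp
qed (simp_all add: scaleC_add_right scaleC_zero_right tensor_eq.refl tensor_eq.append
    tensor_eq.commute tensor_eq.zero tensor_eq.add_left tensor_eq.add_right)

lemma fsum_scale_scale: "fsum_scale c (fsum_scale d xs) = fsum_scale (c * d) xs"
  by (induction xs) (auto simp: scaleC_scaleC)

lemma fsum_scale_one: "fsum_scale 1 xs = xs"
  by (induction xs) (auto simp: scaleC_one)

lemma fsum_scale_zero: "tensor_eq (fsum_scale 0 xs) []"
proof (induction xs)
  case (Cons p xs)
  obtain a b where p: "p = (a, b)" by (cases p)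
  have "tensor_eq ([(0 *\<^sub>C a, b)] @ fsum_scale 0 xs) ([] @ [])"
    using Cons by (intro tensor_eq.append) (simp_all add: scaleC_zero_left tensor_eq.zero)
  then show ?case by (simp add: p)
qed (simp add: tensor_eq.refl)

lemma tensor_eq_interleave: "tensor_eq ((xs @ ys) @ (xs' @ ys')) ((xs @ xs') @ (ys @ ys'))"
  using tensor_eq_append_left[OF tensor_eq.append[OF tensor_eq.commute[of ys xs'] tensor_eq.refl[of ys']], of xs]
  by simp

lemma fsum_scale_add: "tensor_eq (fsum_scale (c + d) xs) (fsum_scale c xs @ fsum_scale d xs)"
proof (induction xs)
  case (Cons p xs)
  obtain a b where p: "p = (a, b)" by (cases p)
  have "tensor_eq ([((c + d) *\<^sub>C a, b)] @ fsum_scale (c + d) xs)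
      ([(c *\<^sub>C a, b), (d *\<^sub>C a, b)] @ (fsum_scale c xs @ fsum_scale d xs))"
    using Cons by (intro tensor_eq.append) (simp_all add: scaleC_add_left tensor_eq.add_left)
  from tensor_eq.trans[OF this] have "tensor_eq ([((c + d) *\<^sub>C a, b)] @ fsum_scale (c + d) xs)
      (([(c *\<^sub>C a, b)] @ fsum_scale c xs) @ ([(d *\<^sub>C a, b)] @ fsum_scale d xs))"
    using tensor_eq_interleave[of "[(c *\<^sub>C a, b)]" "[(d *\<^sub>C a, b)]" "fsum_scale c xs" "fsum_scale d xs"]
    by simp
  then show ?case by (simp add: p)
qed (simp add: tensor_eq.refl)

lemma fsum_cancel: "tensor_eq (xs @ fsum_scale (-1) xs) []"
proof -
  have "tensor_eq (fsum_scale 0 xs) (xs @ fsum_scale (-1) xs)"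
    using fsum_scale_add[of 1 "-1" xs] by (simp add: fsum_scale_one)
  from tensor_eq.trans[OF tensor_eq.sym[OF this] fsum_scale_zero] show ?thesis .
qed

lemma projective_norm_bdd_below: "bdd_below {fsum_norm ys |ys. tensor_eq ys xs}"
  by (rule bdd_belowI[of _ 0]) (auto simp: fsum_norm_nonneg)

lemma projective_norm_le: "tensor_eq ys xs \<Longrightarrow> projective_norm xs \<le> fsum_norm ys"
  unfolding projective_norm_def by (rule cInf_lower[OF _ projective_norm_bdd_below]) auto

lemma projective_norm_ge:
  "(\<And>ys. tensor_eq ys xs \<Longrightarrow> r \<le> fsum_norm ys) \<Longrightarrow> r \<le> projective_norm xs"
  unfolding projective_norm_def by (rule cInf_greatest) (auto intro: tensor_eq.refl)

lemma projective_norm_approx: "0 < e \<Longrightarrow> \<exists>ys. tensor_eq ys xs \<and> fsum_norm ys < projective_norm xs + e"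
  using projective_norm_ge[of xs "projective_norm xs + e"] by (meson less_add_same_cancel1 not_le)

lemma projective_norm_nonneg: "0 \<le> projective_norm xs"
  by (rule projective_norm_ge) (rule fsum_norm_nonneg)

lemma projective_norm_cong: "tensor_eq xs ys \<Longrightarrow> projective_norm xs = projective_norm ys"
proof (rule order_antisym)
  assume eq: "tensor_eq xs ys"
  show "projective_norm xs \<le> projective_norm ys"
    by (rule projective_norm_ge, rule projective_norm_le, erule tensor_eq.trans[OF _ tensor_eq.sym[OF eq]])
  show "projective_norm ys \<le> projective_norm xs"
    by (rule projective_norm_ge, rule projective_norm_le, erule tensor_eq.trans[OF _ eq])
qed

lemma projective_norm_Nil:
  "projective_norm ([] :: ('a::complex_normed_vector \<times> 'b::complex_normed_vector) list) = 0"
proof (rule order_antisym[OF _ projective_norm_nonneg])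
  show "projective_norm ([] :: ('a \<times> 'b) list) \<le> 0"
    using projective_norm_le[OF tensor_eq.refl[of "[] :: ('a \<times> 'b) list"]] by simp
qed

lemma projective_norm_triangle: "projective_norm (xs @ ys) \<le> projective_norm xs + projective_norm ys"
proof (rule field_le_epsilon)
  fix e :: real
  assume "0 < e"
  then obtain xs' ys' where "tensor_eq xs' xs" "fsum_norm xs' < projective_norm xs + e / 2"
    "tensor_eq ys' ys" "fsum_norm ys' < projective_norm ys + e / 2"
    using projective_norm_approx[of "e / 2"] by (meson half_gt_zero)
  with projective_norm_le[OF tensor_eq.append[of xs' xs ys' ys]]
  show "projective_norm (xs @ ys) \<le> projective_norm xs + projective_norm ys + e" by simp
qed

lemma projective_norm_scale: "projective_norm (fsum_scale c xs) = cmod c * projective_norm xs"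
proof -
  have le: "projective_norm (fsum_scale c xs) \<le> cmod c * projective_norm xs" if "c \<noteq> 0"
    for c and xs :: "('a \<times> 'b) list"
  proof -
    have "projective_norm (fsum_scale c xs) / cmod c \<le> projective_norm xs"
    proof (rule projective_norm_ge)
      fix ys
      assume "tensor_eq ys xs"
      then show "projective_norm (fsum_scale c xs) / cmod c \<le> fsum_norm ys"
        using projective_norm_le[OF tensor_eq_fsum_scale[of ys xs c]] that
        by (simp add: fsum_norm_scale field_simps)
    qed
    then show ?thesis using that by (simp add: field_simps)
  qed
  show ?thesis
  proof (cases "c = 0")
    case True
    then show ?thesis
      using projective_norm_cong[OF fsum_scale_zero[of xs]] by (simp add: projective_norm_Nil)
  next
    case False
    then have "projective_norm xs \<le> cmod (inverse c) * projective_norm (fsum_scale c xs)"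
      using le[of "inverse c" "fsum_scale c xs"] by (simp add: fsum_scale_scale fsum_scale_one)
    then have "cmod c * projective_norm xs \<le> projective_norm (fsum_scale c xs)"
      using False by (simp only: norm_inverse) (simp add: field_simps)
    with le[of c xs] False show ?thesis by simp
  qed
qed

text \<open>The algebraic tensor product with the projective norm. By the Hahn-Banach theorem that norm
  is definite on the algebraic tensor product, so the relation below identifies no more formal sums
  than \<^const>\<open>tensor_eq\<close> does; stating it through the norm makes this quotient a normed
  space without having to invoke that theorem.\<close>

definition tensor_rel ::
    "('a::complex_normed_vector \<times> 'b::complex_normed_vector) list \<Rightarrow> ('a \<times> 'b) list \<Rightarrow> bool"
  where "tensor_rel xs ys \<longleftrightarrow> projective_norm (xs @ fsum_scale (-1) ys) = 0"

lemma tensor_eq_imp_rel: "tensor_eq xs ys \<Longrightarrow> tensor_rel xs ys"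
  unfolding tensor_rel_def
  using projective_norm_cong[OF tensor_eq.append[OF tensor_eq.refl tensor_eq_fsum_scale], of ys xs xs "-1"]
    projective_norm_cong[OF fsum_cancel[of xs]]
  by (simp add: projective_norm_Nil tensor_eq.sym)

lemma projective_norm_diff_le:
  "projective_norm xs \<le> projective_norm (xs @ fsum_scale (-1) ys) + projective_norm ys"
proof -
  have "tensor_eq ((xs @ fsum_scale (-1) ys) @ ys) xs"
    using tensor_eq_append_left[OF tensor_eq.trans[OF tensor_eq.commute fsum_cancel], of xs ys] by simp
  from projective_norm_cong[OF this] projective_norm_triangle[of "xs @ fsum_scale (-1) ys" ys]
  show ?thesis by simp
qed

lemma tensor_rel_sym: "tensor_rel xs ys \<Longrightarrow> tensor_rel ys xs"
proof -
  assume "tensor_rel xs ys"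
  then have "projective_norm (fsum_scale (-1) (xs @ fsum_scale (-1) ys)) = 0"
    by (simp add: tensor_rel_def projective_norm_scale del: fsum_scale_simps)
  then show "tensor_rel ys xs"
    using projective_norm_cong[OF tensor_eq.commute[of "fsum_scale (-1) xs" ys]]
    by (simp add: tensor_rel_def fsum_scale_scale fsum_scale_one)
qed

lemma tensor_rel_trans:
  assumes "tensor_rel xs ys" "tensor_rel ys zs"
  shows "tensor_rel xs zs"
proof -
  let ?m = "fsum_scale (-1)"
  have "tensor_eq ((xs @ ?m ys) @ (ys @ ?m zs)) (xs @ ?m zs)"
    using tensor_eq_append_left[OF tensor_eq.append[OF tensor_eq.trans[OF tensor_eq.commute fsum_cancel[of ys]]
          tensor_eq.refl[of "?m zs"]], of xs]
    by simp
  from projective_norm_cong[OF this] projective_norm_triangle[of "xs @ ?m ys" "ys @ ?m zs"] assms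
    projective_norm_nonneg[of "xs @ ?m zs"]
  show ?thesis by (simp add: tensor_rel_def)
qed

lemma tensor_rel_append:
  assumes "tensor_rel xs xs'" "tensor_rel ys ys'"
  shows "tensor_rel (xs @ ys) (xs' @ ys')"
proof -
  let ?m = "fsum_scale (-1)"
  have "projective_norm ((xs @ ys) @ ?m (xs' @ ys')) = projective_norm ((xs @ ?m xs') @ (ys @ ?m ys'))"
    using projective_norm_cong[OF tensor_eq_interleave[of xs ys "?m xs'" "?m ys'"]] by simp
  with projective_norm_triangle[of "xs @ ?m xs'" "ys @ ?m ys'"] assms
    projective_norm_nonneg[of "(xs @ ys) @ ?m (xs' @ ys')"]
  show ?thesis by (simp add: tensor_rel_def)
qed

lemma tensor_rel_scale:
  assumes "tensor_rel xs ys"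
  shows "tensor_rel (fsum_scale c xs) (fsum_scale c ys)"
proof -
  have "projective_norm (fsum_scale c (xs @ fsum_scale (-1) ys)) = 0"
    using assms by (simp add: tensor_rel_def projective_norm_scale del: fsum_scale_simps)
  then show ?thesis by (simp add: tensor_rel_def fsum_scale_scale)
qed

quotient_type (overloaded) ('a, 'b) alg_tensor =
    "('a::complex_normed_vector \<times> 'b::complex_normed_vector) list" / tensor_rel
  by (rule equivpI)
    (auto intro!: reflpI sympI transpI intro: tensor_eq_imp_rel tensor_eq.refl tensor_rel_sym tensor_rel_trans)

instantiation alg_tensor :: (complex_normed_vector, complex_normed_vector) complex_normed_vector
begin

lift_definition norm_alg_tensor :: "('a, 'b) alg_tensor \<Rightarrow> real" is projective_norm
proof -
  fix xs ys :: "('a \<times> 'b) list"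
  assume "tensor_rel xs ys"
  with tensor_rel_sym[OF this] show "projective_norm xs = projective_norm ys"
    using projective_norm_diff_le[of xs ys] projective_norm_diff_le[of ys xs]
    by (simp add: tensor_rel_def)
qed

lift_definition zero_alg_tensor :: "('a, 'b) alg_tensor" is "[]" .
lift_definition plus_alg_tensor :: "('a, 'b) alg_tensor \<Rightarrow> ('a, 'b) alg_tensor \<Rightarrow> ('a, 'b) alg_tensor"
  is "\<lambda>xs ys. xs @ ys" by (rule tensor_rel_append)
lift_definition scaleC_alg_tensor :: "complex \<Rightarrow> ('a, 'b) alg_tensor \<Rightarrow> ('a, 'b) alg_tensor"
  is fsum_scale by (rule tensor_rel_scale)
definition scaleR_alg_tensor :: "real \<Rightarrow> ('a, 'b) alg_tensor \<Rightarrow> ('a, 'b) alg_tensor"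
  where "scaleR_alg_tensor r x = complex_of_real r *\<^sub>C x"
definition uminus_alg_tensor :: "('a, 'b) alg_tensor \<Rightarrow> ('a, 'b) alg_tensor"
  where "uminus_alg_tensor x = (-1) *\<^sub>C x"
definition minus_alg_tensor :: "('a, 'b) alg_tensor \<Rightarrow> ('a, 'b) alg_tensor \<Rightarrow> ('a, 'b) alg_tensor"
  where "minus_alg_tensor x y = x + (-1) *\<^sub>C y"
definition dist_alg_tensor :: "('a, 'b) alg_tensor \<Rightarrow> ('a, 'b) alg_tensor \<Rightarrow> real"
  where "dist_alg_tensor x y = norm (x - y)"
definition sgn_alg_tensor :: "('a, 'b) alg_tensor \<Rightarrow> ('a, 'b) alg_tensor"
  where "sgn_alg_tensor x = scaleR (inverse (norm x)) x"
definition uniformity_alg_tensor :: "(('a, 'b) alg_tensor \<times> ('a, 'b) alg_tensor) filter"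
  where "uniformity_alg_tensor = (INF e\<in>{0 <..}. principal {(x, y). dist x y < e})"
definition open_alg_tensor :: "('a, 'b) alg_tensor set \<Rightarrow> bool"
  where "open_alg_tensor S = (\<forall>x\<in>S. \<forall>\<^sub>F (x', y) in uniformity. x' = x \<longrightarrow> y \<in> S)"

instance
proof
  note rI = tensor_eq_imp_rel
  fix x y z :: "('a, 'b) alg_tensor" and c d :: complex and r s :: real
  show "x + y + z = x + (y + z)" by transfer (simp add: rI tensor_eq.refl)
  show "x + y = y + x" by transfer (rule rI[OF tensor_eq.commute])
  show "0 + x = x" by transfer (simp add: rI tensor_eq.refl)
  show "x - y = x + - y" by (simp add: minus_alg_tensor_def uminus_alg_tensor_def)
  have "x + (-1) *\<^sub>C x = 0" by transfer (rule rI[OF fsum_cancel])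
  moreover have "x + (-1) *\<^sub>C x = (-1) *\<^sub>C x + x" by transfer (rule rI[OF tensor_eq.commute])
  ultimately show "- x + x = 0" by (simp add: uminus_alg_tensor_def)
  show C1: "c *\<^sub>C (x + y) = c *\<^sub>C x + c *\<^sub>C y" for c and x y :: "('a, 'b) alg_tensor"
    by transfer (simp add: rI tensor_eq.refl)
  show C2: "(c + d) *\<^sub>C x = c *\<^sub>C x + d *\<^sub>C x" for c d and x :: "('a, 'b) alg_tensor"
    by transfer (rule rI[OF fsum_scale_add])
  show C3: "c *\<^sub>C d *\<^sub>C x = (c * d) *\<^sub>C x" for c d and x :: "('a, 'b) alg_tensor"
    by transfer (simp add: fsum_scale_scale rI tensor_eq.refl)
  show "r *\<^sub>R x = complex_of_real r *\<^sub>C x" by (rule scaleR_alg_tensor_def)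
  show "r *\<^sub>R (x + y) = r *\<^sub>R x + r *\<^sub>R y" by (simp add: scaleR_alg_tensor_def C1)
  show "(r + s) *\<^sub>R x = r *\<^sub>R x + s *\<^sub>R x" by (simp add: scaleR_alg_tensor_def C2)
  show "r *\<^sub>R s *\<^sub>R x = (r * s) *\<^sub>R x" by (simp add: scaleR_alg_tensor_def C3)
  have "1 *\<^sub>C x = x" by transfer (simp add: fsum_scale_one rI tensor_eq.refl)
  then show "1 *\<^sub>R x = x" by (simp add: scaleR_alg_tensor_def)
  show "sgn x = inverse (norm x) *\<^sub>R x" by (simp add: sgn_alg_tensor_def)
  show "dist x y = norm (x - y)" by (rule dist_alg_tensor_def)
  show "(norm x = 0) = (x = 0)" by transfer (simp add: tensor_rel_def)
  show "norm (x + y) \<le> norm x + norm y" by transfer (rule projective_norm_triangle)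
  show nC: "norm (c *\<^sub>C x) = cmod c * norm x" for c and x :: "('a, 'b) alg_tensor"
    by transfer (rule projective_norm_scale)
  show "norm (r *\<^sub>R x) = \<bar>r\<bar> * norm x" by (simp add: scaleR_alg_tensor_def nC)
qed (simp_all add: uniformity_alg_tensor_def open_alg_tensor_def)

end

type_synonym ('a, 'b) ptensor = "('a, 'b) alg_tensor completion"

lift_definition alg_tensor_sum ::
    "('a::complex_normed_vector \<times> 'b::complex_normed_vector) list \<Rightarrow> ('a, 'b) alg_tensor" is "\<lambda>xs. xs" .

definition tensor :: "'a::complex_normed_vector \<Rightarrow> 'b::complex_normed_vector \<Rightarrow> ('a, 'b) ptensor"
    (infixr "\<otimes>\<^sub>p" 72)
  where "a \<otimes>\<^sub>p b = completion_embed (alg_tensor_sum [(a, b)])"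

definition alg_tensor_lift ::
    "('a::complex_normed_vector \<Rightarrow> 'b::complex_normed_vector \<Rightarrow> 'c::complex_normed_vector)
      \<Rightarrow> ('a, 'b) alg_tensor \<Rightarrow> 'c"
  where "alg_tensor_lift B t = (\<Sum>(a, b)\<leftarrow>rep_alg_tensor t. B a b)"

definition ptensor_lift ::
    "('a::complex_normed_vector \<Rightarrow> 'b::complex_normed_vector \<Rightarrow> 'c::complex_banach)
      \<Rightarrow> ('a, 'b) ptensor \<Rightarrow> 'c"
  where "ptensor_lift B = completion_extend (alg_tensor_lift B)"

lemma norm_alg_tensor_sum: "norm (alg_tensor_sum xs) = projective_norm xs"
  by transfer simp

lemma alg_tensor_sum_append: "alg_tensor_sum (xs @ ys) = alg_tensor_sum xs + alg_tensor_sum ys"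
  by transfer (simp add: tensor_eq_imp_rel tensor_eq.refl)

lemma alg_tensor_sum_Nil: "alg_tensor_sum [] = 0"
  by transfer (simp add: tensor_eq_imp_rel tensor_eq.refl)

lemma alg_tensor_sum_scale: "alg_tensor_sum (fsum_scale c xs) = c *\<^sub>C alg_tensor_sum xs"
  by transfer (simp add: tensor_eq_imp_rel tensor_eq.refl)

lemma alg_tensor_sum_cong: "tensor_eq xs ys \<Longrightarrow> alg_tensor_sum xs = alg_tensor_sum ys"
  by transfer (rule tensor_eq_imp_rel)

lemma alg_tensor_sum_surj: "\<exists>xs. t = alg_tensor_sum xs"
  by transfer (auto intro: tensor_eq_imp_rel tensor_eq.refl)

lemma completion_embed_zero: "completion_embed 0 = 0"
  using completion_embed_diff[of 0 0] by simp

lemma completion_embed_alg_tensor_sum: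
  "completion_embed (alg_tensor_sum xs) = (\<Sum>(a, b)\<leftarrow>xs. a \<otimes>\<^sub>p b)"
proof (induction xs)
  case (Cons p xs)
  obtain a b where p: "p = (a, b)" by (cases p)
  have "completion_embed (alg_tensor_sum ([p] @ xs)) = a \<otimes>\<^sub>p b + completion_embed (alg_tensor_sum xs)"
    unfolding alg_tensor_sum_append completion_embed_add by (simp add: p tensor_def)
  with Cons show ?case by (simp add: p)
qed (simp add: alg_tensor_sum_Nil completion_embed_zero)

lemma norm_ptensor_sum:
  "norm (\<Sum>(a, b)\<leftarrow>xs. a \<otimes>\<^sub>p b) = Inf {\<Sum>(a, b)\<leftarrow>ys. norm a * norm b |ys. tensor_eq ys xs}"
  unfolding completion_embed_alg_tensor_sum[symmetric] norm_completion_embed norm_alg_tensor_sum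
    projective_norm_def fsum_norm_def ..

lemma bounded_cbilinear_tensor:
  "bounded_cbilinear (tensor :: 'a::complex_normed_vector \<Rightarrow> 'b::complex_normed_vector \<Rightarrow> _)"
proof -
  have sL: "(c *\<^sub>C a) \<otimes>\<^sub>p b = c *\<^sub>C (a \<otimes>\<^sub>p b)" for c and a :: 'a and b :: 'b
    using alg_tensor_sum_scale[of c "[(a, b)]"] by (simp add: tensor_def completion_embed_scaleC)
  have sR: "a \<otimes>\<^sub>p (c *\<^sub>C b) = c *\<^sub>C (a \<otimes>\<^sub>p b)" for c and a :: 'a and b :: 'b
    using alg_tensor_sum_cong[OF tensor_eq.scale[of c a b]] sL[of c a b] by (simp add: tensor_def)
  have aL: "(a + a') \<otimes>\<^sub>p b = a \<otimes>\<^sub>p b + a' \<otimes>\<^sub>p b" for a a' :: 'a and b :: 'b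
    using alg_tensor_sum_cong[OF tensor_eq.add_left[of a a' b]] alg_tensor_sum_append[of "[(a, b)]" "[(a', b)]"]
    by (simp add: tensor_def completion_embed_add)
  have aR: "a \<otimes>\<^sub>p (b + b') = a \<otimes>\<^sub>p b + a \<otimes>\<^sub>p b'" for a :: 'a and b b' :: 'b
    using alg_tensor_sum_cong[OF tensor_eq.add_right[of a b b']] alg_tensor_sum_append[of "[(a, b)]" "[(a, b')]"]
    by (simp add: tensor_def completion_embed_add)
  have n: "norm (a \<otimes>\<^sub>p b) \<le> norm a * norm b * 1" for a :: 'a and b :: 'b
    using projective_norm_le[OF tensor_eq.refl, of "[(a, b)]"]
    by (simp add: tensor_def norm_completion_embed norm_alg_tensor_sum)
  have "bounded_bilinear (tensor :: 'a \<Rightarrow> 'b \<Rightarrow> _)"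
    using n by unfold_locales (auto simp: aL aR sL sR scaleR_scaleC intro!: exI[of _ 1])
  with sL sR show ?thesis by (simp add: bounded_cbilinear_def)
qed

lemma bounded_bilinear_fsum_eq:
  assumes B: "bounded_cbilinear B" and "tensor_eq xs ys"
  shows "(\<Sum>(a, b)\<leftarrow>xs. B a b) = (\<Sum>(a, b)\<leftarrow>ys. B a b)"
proof -
  from B interpret bounded_bilinear B by (simp add: bounded_cbilinear_def)
  from assms(2) show ?thesis
  proof (induction rule: tensor_eq.induct)
    case (scale c a b)
    then show ?case using B by (simp add: bounded_cbilinear_def)
  qed (auto simp: zero_left add_left add_right add.commute)
qed

lemma bounded_bilinear_fsum_bound:
  assumes B: "bounded_cbilinear B" and K: "\<And>a b. norm (B a b) \<le> norm a * norm b * K" and "0 < K"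
  shows "norm (\<Sum>(a, b)\<leftarrow>xs. B a b) \<le> projective_norm xs * K"
proof -
  have le: "norm (\<Sum>(a, b)\<leftarrow>ys. B a b) \<le> fsum_norm ys * K" for ys
  proof (induction ys)
    case (Cons p ys)
    obtain a b where p: "p = (a, b)" by (cases p)
    show ?case
      using Cons K[of a b] norm_triangle_ineq[of "B a b" "\<Sum>(a, b)\<leftarrow>ys. B a b"]
      by (simp add: p algebra_simps)
  qed simp
  have "norm (\<Sum>(a, b)\<leftarrow>xs. B a b) / K \<le> projective_norm xs"
    using le bounded_bilinear_fsum_eq[OF B] \<open>0 < K\<close>
    by (intro projective_norm_ge) (metis pos_divide_le_eq)
  then show ?thesis using \<open>0 < K\<close> by (simp add: field_simps)
qed

lemma fsum_bilinear_append_scale: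
  assumes B: "bounded_cbilinear B"
  shows "(\<Sum>(a, b)\<leftarrow>fsum_scale c xs. B a b) = c *\<^sub>C (\<Sum>(a, b)\<leftarrow>xs. B a b)"
proof (induction xs)
  case (Cons p xs)
  then show ?case using B by (cases p) (simp add: bounded_cbilinear_def scaleC_add_right)
qed (simp add: scaleC_zero_right)

lemma alg_tensor_lift_sum:
  assumes B: "bounded_cbilinear B"
  shows "alg_tensor_lift B (alg_tensor_sum xs) = (\<Sum>(a, b)\<leftarrow>xs. B a b)"
proof -
  let ?r = "rep_alg_tensor (alg_tensor_sum xs)"
  have "tensor_rel xs ?r"
    using Quotient3_rel[OF Quotient3_alg_tensor]
    by (metis Quotient3_alg_tensor alg_tensor_sum.abs_eq rep_abs_rsp tensor_eq.refl tensor_eq_imp_rel)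
  then have "projective_norm (xs @ fsum_scale (-1) ?r) = 0" by (simp add: tensor_rel_def)
  moreover from B interpret bounded_bilinear B by (simp add: bounded_cbilinear_def)
  obtain K where "0 < K" "\<And>a b. norm (B a b) \<le> norm a * norm b * K" using pos_bounded by blast
  ultimately have "(\<Sum>(a, b)\<leftarrow>xs @ fsum_scale (-1) ?r. B a b) = 0"
    using bounded_bilinear_fsum_bound[OF B, of K "xs @ fsum_scale (-1) ?r"] by simp
  then show ?thesis
    by (simp add: alg_tensor_lift_def fsum_bilinear_append_scale[OF B] scaleC_minus_one)
qed

lemma bounded_clinear_alg_tensor_lift:
  assumes B: "bounded_cbilinear B"
  shows "bounded_clinear (alg_tensor_lift B)"
proof -
  note S = alg_tensor_lift_sum[OF B]
  from B interpret bounded_bilinear B by (simp add: bounded_cbilinear_def)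
  obtain K where K: "0 < K" "\<And>a b. norm (B a b) \<le> norm a * norm b * K" using pos_bounded by blast
  have add: "alg_tensor_lift B (s + t) = alg_tensor_lift B s + alg_tensor_lift B t" for s t
  proof -
    obtain xs ys where "s = alg_tensor_sum xs" "t = alg_tensor_sum ys" using alg_tensor_sum_surj by blast
    then show ?thesis by (simp add: alg_tensor_sum_append[symmetric] S)
  qed
  have sc: "alg_tensor_lift B (c *\<^sub>C t) = c *\<^sub>C alg_tensor_lift B t" for c t
  proof -
    obtain xs where "t = alg_tensor_sum xs" using alg_tensor_sum_surj by blast
    then show ?thesis by (simp add: alg_tensor_sum_scale[symmetric] S fsum_bilinear_append_scale[OF B])
  qed
  have n: "norm (alg_tensor_lift B t) \<le> norm t * K" for t
  proof -
    obtain xs where "t = alg_tensor_sum xs" using alg_tensor_sum_surj by blast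
    then show ?thesis using bounded_bilinear_fsum_bound[OF B K(2) K(1)] by (simp add: norm_alg_tensor_sum S)
  qed
  have "bounded_linear (alg_tensor_lift B)"
    by (rule bounded_linear_intro[OF add _ n]) (simp add: scaleR_scaleC sc)
  with sc show ?thesis by (simp add: bounded_clinear_def)
qed

lemma bounded_clinear_ptensor_lift:
  "bounded_cbilinear B \<Longrightarrow> bounded_clinear (ptensor_lift B)"
  unfolding ptensor_lift_def
  by (intro bounded_clinear_completion_extend bounded_clinear_alg_tensor_lift)

lemma ptensor_lift_tensor:
  assumes "bounded_cbilinear B"
  shows "ptensor_lift B (a \<otimes>\<^sub>p b) = B a b"
  using bounded_clinear_alg_tensor_lift[OF assms]
  by (simp add: ptensor_lift_def tensor_def completion_extend_embed bounded_clinear_def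
      alg_tensor_lift_sum[OF assms])

lemma bounded_clinear_ptensor_eqI:
  fixes f g :: "('a::complex_normed_vector, 'b::complex_normed_vector) ptensor \<Rightarrow> 'c::complex_normed_vector"
  assumes f: "bounded_clinear f" and g: "bounded_clinear g"
    and eq: "\<And>a b. f (a \<otimes>\<^sub>p b) = g (a \<otimes>\<^sub>p b)"
  shows "f = g"
proof (rule bounded_clinear_completion_unique[OF f g])
  fix t :: "('a, 'b) alg_tensor"
  obtain xs where t: "t = alg_tensor_sum xs" using alg_tensor_sum_surj by blast
  interpret f: bounded_linear f using f by (simp add: bounded_clinear_def)
  interpret g: bounded_linear g using g by (simp add: bounded_clinear_def)
  have "f (\<Sum>(a, b)\<leftarrow>xs. a \<otimes>\<^sub>p b) = g (\<Sum>(a, b)\<leftarrow>xs. a \<otimes>\<^sub>p b)"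
    by (induction xs) (auto simp: f.add g.add f.zero g.zero eq)
  then show "f (completion_embed t) = g (completion_embed t)"
    by (simp add: t completion_embed_alg_tensor_sum)
qed


lemma norm_ptensor_lift_le:
  fixes B :: "'a::complex_normed_vector \<Rightarrow> 'b::complex_normed_vector \<Rightarrow> 'c::complex_banach"
  assumes B: "bounded_cbilinear B" and K: "\<And>a b. norm (B a b) \<le> norm a * norm b * K" and "0 \<le> K"
  shows "norm (ptensor_lift B t) \<le> norm t * K"
proof (cases "K = 0")
  case True
  then have "B a b = 0" for a b using K[of a b] by simp
  then have "ptensor_lift B = (\<lambda>_. 0)"
    by (intro bounded_clinear_ptensor_eqI bounded_clinear_ptensor_lift[OF B])
      (auto simp: ptensor_lift_tensor[OF B] bounded_clinear_def scaleC_zero_right)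
  then show ?thesis using True by simp
next
  case False
  with \<open>0 \<le> K\<close> have "0 < K" by simp
  have bl: "bounded_linear (alg_tensor_lift B)"
    using bounded_clinear_alg_tensor_lift[OF B] by (simp add: bounded_clinear_def)
  have n: "norm (alg_tensor_lift B s) \<le> norm s * K" for s
  proof -
    obtain xs where "s = alg_tensor_sum xs" using alg_tensor_sum_surj by blast
    then show ?thesis
      using bounded_bilinear_fsum_bound[OF B K \<open>0 < K\<close>] by (simp add: norm_alg_tensor_sum alg_tensor_lift_sum[OF B])
  qed
  show ?thesis unfolding ptensor_lift_def
  proof (rule LIMSEQ_le)
    show "(\<lambda>n. norm (alg_tensor_lift B (rep_completion t n))) \<longlonglongrightarrow> norm (completion_extend (alg_tensor_lift B) t)"
      by (rule tendsto_norm[OF completion_extend_limit[OF bl rep_completion_Cauchy rep_completion_limit]])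
    show "(\<lambda>n. norm (rep_completion t n) * K) \<longlonglongrightarrow> norm t * K"
      using tendsto_mult_right[OF tendsto_norm[OF rep_completion_limit[of t]], of K]
      by (simp add: norm_completion_embed)
  qed (use n in auto)
qed


section \<open>Banach bimodules\<close>

locale banach_bimodule =
  fixes l :: "'a::complex_banach_algebra \<Rightarrow> 'x::complex_banach \<Rightarrow> 'x"
    and r :: "'x \<Rightarrow> 'a \<Rightarrow> 'x"
  assumes bounded_left: "bounded_cbilinear l"
    and bounded_right: "bounded_cbilinear r"
    and left_assoc: "l (a * b) x = l a (l b x)"
    and right_assoc: "r x (a * b) = r (r x a) b"
    and left_right: "r (l a x) b = l a (r x b)"

text \<open>The actions on the dual of a bimodule; each is the adjoint of the action on the other side.\<close>

definition dual_left ::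
    "('x::complex_normed_vector \<Rightarrow> 'a \<Rightarrow> 'x) \<Rightarrow> 'a \<Rightarrow> 'x cdual \<Rightarrow> 'x cdual"
  where "dual_left r a f = banach_adjoint (\<lambda>x. r x a) f"

definition dual_right ::
    "('a \<Rightarrow> 'x::complex_normed_vector \<Rightarrow> 'x) \<Rightarrow> 'x cdual \<Rightarrow> 'a \<Rightarrow> 'x cdual"
  where "dual_right l f a = banach_adjoint (\<lambda>x. l a x) f"

definition ptensor_left ::
    "'a::complex_banach_algebra \<Rightarrow> ('a, 'a) ptensor \<Rightarrow> ('a, 'a) ptensor"
  where "ptensor_left a = ptensor_lift (\<lambda>b c. (a * b) \<otimes>\<^sub>p c)"

definition ptensor_right ::
    "('a::complex_banach_algebra, 'a) ptensor \<Rightarrow> 'a \<Rightarrow> ('a, 'a) ptensor"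
  where "ptensor_right t a = ptensor_lift (\<lambda>b c. b \<otimes>\<^sub>p (c * a)) t"

definition diagonal_op :: "('a::complex_banach_algebra, 'a) ptensor \<Rightarrow> 'a"
  where "diagonal_op = ptensor_lift (\<lambda>a b. a * b)"

lemma bounded_cbilinearI:
  fixes f :: "'a::complex_normed_vector \<Rightarrow> 'b::complex_normed_vector \<Rightarrow> 'c::complex_normed_vector"
  assumes "\<And>x x' y. f (x + x') y = f x y + f x' y" "\<And>x y y'. f x (y + y') = f x y + f x y'"
    and "\<And>c x y. f (c *\<^sub>C x) y = c *\<^sub>C f x y" "\<And>c x y. f x (c *\<^sub>C y) = c *\<^sub>C f x y"
    and "\<And>x y. norm (f x y) \<le> norm x * norm y * K"
  shows "bounded_cbilinear f"
proof -
  have "bounded_bilinear f"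
    by unfold_locales (use assms in \<open>auto simp: scaleR_scaleC\<close>)
  with assms show ?thesis by (simp add: bounded_cbilinear_def)
qed

lemma bounded_cbilinear_left: "bounded_cbilinear f \<Longrightarrow> bounded_clinear (\<lambda>x. f x y)"
  by (simp add: bounded_cbilinear_def bounded_clinear_def bounded_bilinear.bounded_linear_left)

lemma bounded_cbilinear_right: "bounded_cbilinear f \<Longrightarrow> bounded_clinear (f x)"
  by (simp add: bounded_cbilinear_def bounded_clinear_def bounded_bilinear.bounded_linear_right)

lemma bounded_cbilinear_simps:
  assumes "bounded_cbilinear f"
  shows "f (x + x') y = f x y + f x' y" "f x (y + y') = f x y + f x y'"
    "f (c *\<^sub>C x) y = c *\<^sub>C f x y" "f x (c *\<^sub>C y) = c *\<^sub>C f x y"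
  using assms by (auto simp: bounded_cbilinear_def bounded_bilinear.add_left bounded_bilinear.add_right)

lemma bounded_clinear_simps:
  assumes "bounded_clinear f"
  shows "f (x + y) = f x + f y" "f (c *\<^sub>C x) = c *\<^sub>C f x"
  using assms by (auto simp: bounded_clinear_def linear_simps)

lemma bounded_clinear_add:
  "bounded_clinear f \<Longrightarrow> bounded_clinear g \<Longrightarrow> bounded_clinear (\<lambda>x. f x + g x)"
  by (auto simp: bounded_clinear_def bounded_linear_add scaleC_add_right)

lemma bounded_clinear_scaleC:
  "bounded_clinear f \<Longrightarrow> bounded_clinear (\<lambda>x. c *\<^sub>C f x)"
  using bounded_linear_compose[OF bounded_linear_scaleC[of c], of f]
  by (auto simp: bounded_clinear_def scaleC_scaleC mult.commute)

lemma cdual_norm_bound: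
  "0 \<le> K \<Longrightarrow> (\<And>x. cmod (cdual_apply f x) \<le> K * norm x) \<Longrightarrow> norm f \<le> K"
  unfolding norm_cdual_onorm by (rule onorm_bound)

lemma cdual_apply_norm: "cmod (cdual_apply f x) \<le> norm f * norm x"
  unfolding norm_cdual_onorm
  by (rule onorm) (use bounded_clinear_cdual_apply in \<open>auto simp: bounded_clinear_def\<close>)

context banach_bimodule
begin

lemma dual_left_apply: "cdual_apply (dual_left r a f) x = cdual_apply f (r x a)"
  by (simp add: dual_left_def cdual_apply_banach_adjoint bounded_cbilinear_left[OF bounded_right])

lemma dual_right_apply: "cdual_apply (dual_right l f a) x = cdual_apply f (l a x)"
  by (simp add: dual_right_def cdual_apply_banach_adjoint bounded_cbilinear_right[OF bounded_left])

lemma dual_bimodule: "banach_bimodule (dual_left r) (dual_right l)"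
proof
  note [simp] = dual_left_apply dual_right_apply cdual_apply_add cdual_apply_scaleC
    bounded_cbilinear_simps[OF bounded_left] bounded_cbilinear_simps[OF bounded_right]
    bounded_clinear_simps[OF bounded_clinear_cdual_apply] scaleC_complex_def
  obtain L where L: "0 \<le> L" "\<And>a x. norm (l a x) \<le> norm a * norm x * L"
    using bounded_left bounded_bilinear.nonneg_bounded unfolding bounded_cbilinear_def by blast
  obtain R where R: "0 \<le> R" "\<And>x a. norm (r x a) \<le> norm x * norm a * R"
    using bounded_right bounded_bilinear.nonneg_bounded unfolding bounded_cbilinear_def by blast
  show "bounded_cbilinear (dual_left r)"
  proof (rule bounded_cbilinearI)
    fix a f
    show "norm (dual_left r a f) \<le> norm a * norm f * R"
    proof (rule cdual_norm_bound)
      show "cmod (cdual_apply (dual_left r a f) x) \<le> norm a * norm f * R * norm x" for x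
        using order_trans[OF cdual_apply_norm mult_left_mono[OF R(2)[of x a] norm_ge_zero[of f]]]
        by (simp add: mult_ac)
    qed (use R(1) in simp)
  qed (auto intro!: cdual_eqI)
  show "bounded_cbilinear (dual_right l)"
  proof (rule bounded_cbilinearI)
    fix a f
    show "norm (dual_right l f a) \<le> norm f * norm a * L"
    proof (rule cdual_norm_bound)
      show "cmod (cdual_apply (dual_right l f a) x) \<le> norm f * norm a * L * norm x" for x
        using order_trans[OF cdual_apply_norm mult_left_mono[OF L(2)[of a x] norm_ge_zero[of f]]]
        by (simp add: mult_ac)
    qed (use L(1) in simp)
  qed (auto intro!: cdual_eqI)
qed (auto intro!: cdual_eqI simp: dual_left_apply dual_right_apply left_assoc right_assoc left_right)

end

lemma algebra_bimodule:
  "banach_bimodule (\<lambda>a x :: 'a::complex_banach_algebra. a * x) (\<lambda>x a. x * a)"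
  by unfold_locales (auto simp: bounded_cbilinear_mult mult.assoc)

lemma norm_tensor_le: "norm (a \<otimes>\<^sub>p b) \<le> norm a * norm b"
  using projective_norm_le[OF tensor_eq.refl, of "[(a, b)]"]
  by (simp add: tensor_def norm_completion_embed norm_alg_tensor_sum)

lemma ptensor_left_kernel:
  fixes a :: "'a::complex_banach_algebra"
  shows "bounded_cbilinear (\<lambda>b (c::'a). (a * b) \<otimes>\<^sub>p c)" "norm ((a * b) \<otimes>\<^sub>p (c :: 'a)) \<le> norm b * norm c * norm a"
proof -
  show n: "norm ((a * b) \<otimes>\<^sub>p c) \<le> norm b * norm c * norm a" for b c :: 'a
    using order_trans[OF norm_tensor_le mult_right_mono[OF norm_mult_ineq[of a b] norm_ge_zero[of c]]]
    by (simp add: mult_ac)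
  show "bounded_cbilinear (\<lambda>b (c::'a). (a * b) \<otimes>\<^sub>p c)"
    by (rule bounded_cbilinearI[where K="norm a"])
      (rule n | simp add: bounded_cbilinear_simps[OF bounded_cbilinear_tensor] distrib_left mult_scaleC_right)+
qed

lemma ptensor_right_kernel:
  fixes a :: "'a::complex_banach_algebra"
  shows "bounded_cbilinear (\<lambda>(b::'a) c. b \<otimes>\<^sub>p (c * a))" "norm ((b :: 'a) \<otimes>\<^sub>p (c * a)) \<le> norm b * norm c * norm a"
proof -
  show n: "norm (b \<otimes>\<^sub>p (c * a)) \<le> norm b * norm c * norm a" for b c :: 'a
    using order_trans[OF norm_tensor_le mult_left_mono[OF norm_mult_ineq[of c a] norm_ge_zero[of b]]]
    by (simp add: mult_ac)
  show "bounded_cbilinear (\<lambda>(b::'a) c. b \<otimes>\<^sub>p (c * a))"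
    by (rule bounded_cbilinearI[where K="norm a"])
      (rule n | simp add: bounded_cbilinear_simps[OF bounded_cbilinear_tensor] distrib_right mult_scaleC_left)+
qed

lemma ptensor_left_tensor: "ptensor_left a (b \<otimes>\<^sub>p c) = (a * b) \<otimes>\<^sub>p c"
  by (simp add: ptensor_left_def ptensor_lift_tensor ptensor_left_kernel)

lemma ptensor_right_tensor: "ptensor_right (b \<otimes>\<^sub>p c) a = b \<otimes>\<^sub>p (c * a)"
  by (simp add: ptensor_right_def ptensor_lift_tensor ptensor_right_kernel)

lemma diagonal_op_tensor: "diagonal_op (a \<otimes>\<^sub>p b) = a * b"
  by (simp add: diagonal_op_def ptensor_lift_tensor bounded_cbilinear_mult)

lemma bounded_clinear_diagonal_op: "bounded_clinear diagonal_op"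
  unfolding diagonal_op_def by (rule bounded_clinear_ptensor_lift[OF bounded_cbilinear_mult])

lemma ptensor_bimodule:
  "banach_bimodule ptensor_left (ptensor_right :: ('a::complex_banach_algebra, 'a) ptensor \<Rightarrow> _)"
proof -
  have L: "bounded_clinear (ptensor_left a)" for a :: 'a
    unfolding ptensor_left_def by (rule bounded_clinear_ptensor_lift[OF ptensor_left_kernel(1)])
  have R: "bounded_clinear (\<lambda>t. ptensor_right t a)" for a :: 'a
    unfolding ptensor_right_def by (rule bounded_clinear_ptensor_lift[OF ptensor_right_kernel(1)])
  note T = ptensor_left_tensor ptensor_right_tensor bounded_cbilinear_simps[OF bounded_cbilinear_tensor]
    distrib_left distrib_right mult_scaleC_left mult_scaleC_right mult.assoc
  have eqI: "f t = g t"
    if "bounded_clinear f" "bounded_clinear g" "\<And>b c. f (b \<otimes>\<^sub>p c) = g (b \<otimes>\<^sub>p c)"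
    for f g :: "('a, 'a) ptensor \<Rightarrow> ('a, 'a) ptensor" and t
    using bounded_clinear_ptensor_eqI[OF that] by simp
  note add = bounded_clinear_add and sc = bounded_clinear_scaleC and comp = bounded_clinear_compose
  show ?thesis
  proof
    show "bounded_cbilinear (ptensor_left :: 'a \<Rightarrow> _)"
    proof (rule bounded_cbilinearI)
      show "ptensor_left (a + a') t = ptensor_left a t + ptensor_left a' t" for a a' :: 'a and t
        by (rule eqI[OF L add[OF L L]]) (simp add: T)
      show "ptensor_left (c *\<^sub>C a) t = c *\<^sub>C ptensor_left a t" for c and a :: 'a and t
        by (rule eqI[OF L sc[OF L]]) (simp add: T)
      show "norm (ptensor_left a t) \<le> norm a * norm t * 1" for a :: 'a and t
        using norm_ptensor_lift_le[OF ptensor_left_kernel norm_ge_zero, of a t]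
        by (simp add: ptensor_left_def mult.commute)
    qed (simp_all add: bounded_clinear_simps[OF L])
    show "bounded_cbilinear (ptensor_right :: ('a, 'a) ptensor \<Rightarrow> _)"
    proof (rule bounded_cbilinearI)
      show "ptensor_right t (a + a') = ptensor_right t a + ptensor_right t a'" for a a' :: 'a and t
        by (rule eqI[OF R add[OF R R]]) (simp add: T)
      show "ptensor_right t (c *\<^sub>C a) = c *\<^sub>C ptensor_right t a" for c and a :: 'a and t
        by (rule eqI[OF R sc[OF R]]) (simp add: T)
      show "norm (ptensor_right t a) \<le> norm t * norm a * 1" for a :: 'a and t
        using norm_ptensor_lift_le[OF ptensor_right_kernel norm_ge_zero, of a t]
        by (simp add: ptensor_right_def)
    qed (simp_all add: bounded_clinear_simps[OF R])
    fix a b :: 'a and t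
    show "ptensor_left (a * b) t = ptensor_left a (ptensor_left b t)"
      by (rule eqI[OF L comp[OF L L]]) (simp add: T)
    show "ptensor_right t (a * b) = ptensor_right (ptensor_right t a) b"
      by (rule eqI[OF R comp[OF R R]]) (simp add: T)
    show "ptensor_right (ptensor_left a t) b = ptensor_left a (ptensor_right t b)"
      by (rule eqI[OF comp[OF R L] comp[OF L R]]) (simp add: T)
  qed
qed


section \<open>Amenability and biflatness relative to an endomorphism\<close>

text \<open>The set written \<open>Hom(A)\<close> in the literature on \<open>\<sigma>\<close>-amenability.\<close>

definition algebra_endomorphisms :: "('a::complex_banach_algebra \<Rightarrow> 'a) set"
  where "algebra_endomorphisms = {\<sigma>. (\<forall>a b. \<sigma> (a + b) = \<sigma> a + \<sigma> b) \<and> (\<forall>c a. \<sigma> (c *\<^sub>C a) = c *\<^sub>C \<sigma> a) \<and>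
    (\<forall>a b. \<sigma> (a * b) = \<sigma> a * \<sigma> b) \<and> continuous_on UNIV \<sigma>}"

text \<open>A net is given by its family \<open>e\<close> together with the filter of tails of its index set.\<close>

definition bounded_approximate_identity ::
    "('i \<Rightarrow> 'a::complex_banach_algebra) \<Rightarrow> 'i filter \<Rightarrow> bool"
  where "bounded_approximate_identity e F \<longleftrightarrow> F \<noteq> bot \<and> bounded (range e) \<and>
    (\<forall>a. ((\<lambda>i. e i * a) \<longlongrightarrow> a) F) \<and> (\<forall>a. ((\<lambda>i. a * e i) \<longlongrightarrow> a) F)"

definition sigma_biflat :: "('a::complex_banach_algebra \<Rightarrow> 'a) \<Rightarrow> bool"
  where "sigma_biflat \<sigma> \<longleftrightarrow> (\<exists>\<rho> :: ('a, 'a) ptensor cdual \<Rightarrow> 'a cdual.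
    bounded_clinear \<rho> \<and>
    (\<forall>a f. \<rho> (dual_left ptensor_right (\<sigma> a) f) = dual_left (\<lambda>x b. x * b) a (\<rho> f)) \<and>
    (\<forall>a f. \<rho> (dual_right ptensor_left f (\<sigma> a)) = dual_right (\<lambda>b x. b * x) (\<rho> f) a) \<and>
    \<rho> \<circ> banach_adjoint diagonal_op = banach_adjoint \<sigma>)"

definition sigma_derivation ::
    "('a::complex_banach_algebra \<Rightarrow> 'a) \<Rightarrow> ('a \<Rightarrow> 'x::complex_banach \<Rightarrow> 'x) \<Rightarrow> ('x \<Rightarrow> 'a \<Rightarrow> 'x)
      \<Rightarrow> ('a \<Rightarrow> 'x) \<Rightarrow> bool"
  where "sigma_derivation \<sigma> l r D \<longleftrightarrow>
    bounded_clinear D \<and> (\<forall>a b. D (a * b) = l (\<sigma> a) (D b) + r (D a) (\<sigma> b))"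

definition sigma_inner ::
    "('a::complex_banach_algebra \<Rightarrow> 'a) \<Rightarrow> ('a \<Rightarrow> 'x::complex_banach \<Rightarrow> 'x) \<Rightarrow> ('x \<Rightarrow> 'a \<Rightarrow> 'x)
      \<Rightarrow> ('a \<Rightarrow> 'x) \<Rightarrow> bool"
  where "sigma_inner \<sigma> l r D \<longleftrightarrow> (\<exists>x. \<forall>a. D a = l (\<sigma> a) x - r x (\<sigma> a))"

text \<open>A definition cannot quantify over all Banach spaces, so the type of the bimodules is a
  parameter. A theorem concluding \<open>sigma_amenable TYPE('x) \<sigma>\<close> for a type variable
  \<open>'x\<close> that occurs nowhere else asserts the property for every Banach bimodule.\<close>

definition sigma_amenable ::
    "'x::complex_banach itself \<Rightarrow> ('a::complex_banach_algebra \<Rightarrow> 'a) \<Rightarrow> bool"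
  where "sigma_amenable _ \<sigma> \<longleftrightarrow>
    (\<forall>(l :: 'a \<Rightarrow> 'x \<Rightarrow> 'x) r. banach_bimodule l r \<longrightarrow>
      (\<forall>D :: 'a \<Rightarrow> 'x cdual. sigma_derivation \<sigma> (dual_left r) (dual_right l) D \<longrightarrow>
        sigma_inner \<sigma> (dual_left r) (dual_right l) D))"

definition amenable :: "'x::complex_banach itself \<Rightarrow> 'a::complex_banach_algebra itself \<Rightarrow> bool"
  where "amenable X _ \<longleftrightarrow> sigma_amenable X (id :: 'a \<Rightarrow> 'a)"

end

theory Submission
  imports Defs
begin

text \<open>The classical road from biflatness to amenability leads through a virtual diagonal, that is, an
  element \<open>M\<close> of the bidual of the projective tensor square of \<open>A\<close> that commutes with \<open>A\<close> and is
  mapped by the second adjoint of the diagonal operator \<open>\<pi>\<close> to a mixed identity of the bidual of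
  \<open>A\<close>.

  If \<open>\<rho>\<close> witnesses \<open>\<sigma>\<close>-biflatness and \<open>(e i)\<close> is a bounded approximate identity, the functionals
  \<open>\<lambda> \<mapsto> \<langle>\<rho> \<lambda>, e i\<rangle>\<close> are bounded, so by the Banach-Alaoglu theorem (\<open>banach_alaoglu_subnet\<close>) they
  converge pointwise to some \<open>M\<close> along a subnet. The module properties of \<open>\<rho>\<close> give
  \<open>\<langle>M, \<lambda> \<cdot> \<sigma> a\<rangle> = \<langle>\<rho> \<lambda>, a\<rangle> = \<langle>M, \<sigma> a \<cdot> \<lambda>\<rangle>\<close>, and \<open>\<rho> \<circ> \<pi>\<^sup>* = \<sigma>\<^sup>*\<close> makes \<open>M\<close> a virtual diagonal as far as
  the elements of the range of \<open>\<sigma>\<close> are concerned. Both conditions are continuous in the element of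
  \<open>A\<close>, so density of the range extends them to \<open>A\<close> (\<open>sigma_biflat_virtual_diagonal\<close>).

  A virtual diagonal makes every derivation \<open>D\<close> into a dual bimodule \<open>X\<^sup>*\<close> inner
  (\<open>derivation_inner_if_virtual_diagonal\<close>). Averaging \<open>a \<otimes> b \<mapsto> a \<cdot> D b\<close> over \<open>M\<close> gives a functional
  that implements \<open>D\<close> on the part of \<open>X\<^sup>*\<close> on which the mixed identity acts as the identity from the
  left. On the complementary part the left action of \<open>A\<close> is zero, and there \<open>D\<close> is
  implemented by minus its value at the mixed identity. This covers bimodules that are not essential and
  needs no factorization theorem.

  Finally, a \<open>\<sigma>\<close>-derivation is a derivation for the bimodule whose actions are composed with \<open>\<sigma>\<close>,
  so that amenability implies \<open>\<sigma>\<close>-amenability for every bounded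
  endomorphism \<open>\<sigma>\<close> (\<open>sigma_amenable_if_amenable\<close>).\<close>


section \<open>Bounded linear and bilinear maps over the complex numbers\<close>

lemma bounded_clinear_bound:
  assumes "bounded_clinear f"
  obtains K where "0 \<le> K" "\<And>x. norm (f x) \<le> norm x * K"
  using assms bounded_linear.nonneg_bounded unfolding bounded_clinear_def by blast

lemma bounded_cbilinear_bound:
  assumes "bounded_cbilinear f"
  obtains K where "0 \<le> K" "\<And>x y. norm (f x y) \<le> norm x * norm y * K"
  using assms bounded_bilinear.nonneg_bounded unfolding bounded_cbilinear_def by blast

lemma bounded_clinearI:
  fixes f :: "'a::complex_normed_vector \<Rightarrow> 'b::complex_normed_vector"
  assumes "\<And>x y. f (x + y) = f x + f y" "\<And>c x. f (c *\<^sub>C x) = c *\<^sub>C f x"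
    and "\<And>x. norm (f x) \<le> norm x * K"
  shows "bounded_clinear f"
  unfolding bounded_clinear_def
  using assms by (auto intro!: bounded_linear_intro[where K=K] simp: scaleR_scaleC)

lemma bounded_clinear_continuous_on: "bounded_clinear f \<Longrightarrow> continuous_on S f"
  by (simp add: bounded_clinear_def linear_continuous_on)

lemma bounded_clinear_diff:
  assumes "bounded_clinear f"
  shows "f (x - y) = f x - f y"
  using assms by (auto simp: bounded_clinear_def linear_simps)

lemma bounded_clinear_zero: "bounded_clinear f \<Longrightarrow> f 0 = 0"
  using bounded_clinear_diff[of f 0 0] by simp

lemma continuous_clinear_imp_bounded:
  fixes f :: "'a::complex_normed_vector \<Rightarrow> 'b::complex_normed_vector"
  assumes add: "\<And>x y. f (x + y) = f x + f y" and scale: "\<And>c x. f (c *\<^sub>C x) = c *\<^sub>C f x"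
    and cont: "continuous_on UNIV f"
  shows "bounded_clinear f"
proof -
  have f0: "f 0 = 0" using add[of 0 0] by simp
  have scaleR: "f (r *\<^sub>R x) = r *\<^sub>R f x" for r x by (simp add: scaleR_scaleC scale)
  obtain d where d: "0 < d" "\<And>x. norm x < d \<Longrightarrow> norm (f x) < 1"
    using cont[unfolded continuous_on_iff, rule_format, of 0 1] f0 by (auto simp: dist_norm)
  have "norm (f x) \<le> norm x * (2 / d)" for x
  proof (cases "x = 0")
    case False
    let ?t = "d / (2 * norm x)"
    have "norm (?t *\<^sub>R x) < d" using d(1) False by simp
    from d(2)[OF this] have "?t * norm (f x) < 1" using d(1) by (simp add: scaleR)
    then show ?thesis using d(1) False by (simp add: field_simps)
  qed (simp add: f0)
  with add scale show ?thesis by (rule bounded_clinearI)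
qed

lemma bounded_cbilinear_compose_args:
  assumes "bounded_cbilinear B" "bounded_clinear f" "bounded_clinear g"
  shows "bounded_cbilinear (\<lambda>x y. B (f x) (g y))"
  using assms by (auto simp: bounded_cbilinear_def bounded_clinear_def intro: bounded_bilinear.comp)

lemma bounded_clinear_compose_bilinear:
  assumes f: "bounded_clinear f" and B: "bounded_cbilinear B"
  shows "bounded_cbilinear (\<lambda>x y. f (B x y))"
proof -
  obtain K where K: "0 \<le> K" "\<And>x. norm (f x) \<le> norm x * K" by (rule bounded_clinear_bound[OF f]) blast
  obtain L where L: "0 \<le> L" "\<And>x y. norm (B x y) \<le> norm x * norm y * L"
    by (rule bounded_cbilinear_bound[OF B]) blast
  show ?thesis
  proof (rule bounded_cbilinearI)
    show "norm (f (B x y)) \<le> norm x * norm y * (L * K)" for x y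
      using order_trans[OF K(2) mult_right_mono[OF L(2) K(1)], of x y] by (simp add: mult.assoc)
  qed (simp_all add: bounded_cbilinear_simps[OF B] bounded_clinear_simps[OF f])
qed

lemma bounded_clinear_eq_if_dense:
  assumes "bounded_clinear f" "bounded_clinear g" and dense: "closure S = UNIV"
    and eq: "\<And>x. x \<in> S \<Longrightarrow> f x = g x"
  shows "f x = g x"
proof -
  have "closed {x. f x = g x}"
    using assms(1,2) by (intro closed_Collect_eq bounded_clinear_continuous_on)
  then have "closure S \<subseteq> {x. f x = g x}" using eq by (intro closure_minimal) auto
  with dense show ?thesis by auto
qed


section \<open>Functionals depending on parameters\<close>

lemma bounded_cbilinear_cdual_apply: "bounded_cbilinear cdual_apply"
  by (rule bounded_cbilinearI[where K=1])
    (simp_all add: cdual_apply_add cdual_apply_scaleC scaleC_complex_def cdual_apply_norm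
      bounded_clinear_simps[OF bounded_clinear_cdual_apply])

lemma cdual_apply_cdual_of_bilinear:
  "bounded_cbilinear B \<Longrightarrow> cdual_apply (cdual_of (B x)) y = B x y"
  by (simp add: cdual_apply_cdual_of bounded_cbilinear_right)

lemma bounded_clinear_cdual_of:
  fixes B :: "'x::complex_normed_vector \<Rightarrow> 'y::complex_normed_vector \<Rightarrow> complex"
  assumes B: "bounded_cbilinear B"
  shows "bounded_clinear (\<lambda>x. cdual_of (B x))"
proof -
  note [simp] = cdual_apply_cdual_of_bilinear[OF B]
  obtain K where K: "0 \<le> K" "\<And>x y. norm (B x y) \<le> norm x * norm y * K"
    by (rule bounded_cbilinear_bound[OF B]) blast
  show ?thesis
  proof (rule bounded_clinearI)
    show "norm (cdual_of (B x)) \<le> norm x * K" for x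
      using K by (intro cdual_norm_bound) (auto simp: mult_ac)
  qed (auto intro!: cdual_eqI simp: cdual_apply_add cdual_apply_scaleC
      bounded_cbilinear_simps[OF B] scaleC_complex_def)
qed

lemma bounded_clinear_banach_adjoint:
  assumes "bounded_clinear T"
  shows "bounded_clinear (banach_adjoint T)"
  using bounded_clinear_cdual_of[OF bounded_cbilinear_compose_args[OF bounded_cbilinear_cdual_apply _ assms,
      of "\<lambda>f. f"]]
  by (simp add: banach_adjoint_def[abs_def] bounded_clinear_def bounded_linear_ident)

lemma bounded_cbilinear_ptensor_lift:
  fixes T :: "'x::complex_normed_vector \<Rightarrow> 'a::complex_normed_vector \<Rightarrow> 'b::complex_normed_vector
    \<Rightarrow> 'c::complex_banach"
  assumes T: "\<And>x. bounded_cbilinear (T x)"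
    and add: "\<And>x x' a b. T (x + x') a b = T x a b + T x' a b"
    and scale: "\<And>c x a b. T (c *\<^sub>C x) a b = c *\<^sub>C T x a b"
    and bound: "\<And>x a b. norm (T x a b) \<le> norm a * norm b * (norm x * K)" and "0 \<le> K"
  shows "bounded_cbilinear (\<lambda>x. ptensor_lift (T x))"
proof (rule bounded_cbilinearI)
  note L = bounded_clinear_ptensor_lift[OF T]
  have eqI: "f t = g t" if "bounded_clinear f" "bounded_clinear g"
    "\<And>a b. f (a \<otimes>\<^sub>p b) = g (a \<otimes>\<^sub>p b)" for f g :: "('a, 'b) ptensor \<Rightarrow> 'c" and t
    using bounded_clinear_ptensor_eqI[OF that] by simp
  show "ptensor_lift (T (x + x')) t = ptensor_lift (T x) t + ptensor_lift (T x') t" for x x' t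
    by (rule eqI[OF L bounded_clinear_add[OF L L]]) (simp add: ptensor_lift_tensor[OF T] add)
  show "ptensor_lift (T (c *\<^sub>C x)) t = c *\<^sub>C ptensor_lift (T x) t" for c x t
    by (rule eqI[OF L bounded_clinear_scaleC[OF L]]) (simp add: ptensor_lift_tensor[OF T] scale)
  show "norm (ptensor_lift (T x) t) \<le> norm x * norm t * K" for x t
    using norm_ptensor_lift_le[OF T bound, of x t] \<open>0 \<le> K\<close> by (simp add: mult_ac)
qed (simp_all add: bounded_clinear_simps[OF bounded_clinear_ptensor_lift[OF T]])

lemma cdual_ptensor_eqI:
  assumes "\<And>a b. cdual_apply f (a \<otimes>\<^sub>p b) = cdual_apply g (a \<otimes>\<^sub>p b)"
  shows "f = g"
  by (rule cdual_eqI)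
    (use bounded_clinear_ptensor_eqI[OF bounded_clinear_cdual_apply bounded_clinear_cdual_apply assms]
      in simp)


section \<open>The Banach-Alaoglu theorem\<close>

text \<open>A finer proper filter plays the role of a subnet. The functionals lie in a product of
  compact discs; a cluster point there supplies the filter, and it is linear as a pointwise limit.\<close>

lemma banach_alaoglu_subnet:
  fixes g :: "'i \<Rightarrow> 'x::complex_normed_vector cdual" and F :: "'i filter"
  assumes "F \<noteq> bot" and "bounded (range g)"
  obtains F' \<psi> where "F' \<le> F" "F' \<noteq> bot"
    "\<And>x. ((\<lambda>i. cdual_apply (g i) x) \<longlongrightarrow> cdual_apply \<psi> x) F'"
proof -
  obtain K where K: "\<And>i. norm (g i) \<le> K" using \<open>bounded (range g)\<close> by (auto simp: bounded_iff)
  have bound: "cmod (cdual_apply (g i) x) \<le> norm x * K" for i x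
    using order_trans[OF cdual_apply_norm mult_right_mono[OF K norm_ge_zero]] by (simp add: mult.commute)
  define S where "S = (PiE UNIV (\<lambda>x::'x. cball (0::complex) (norm x * K)))"
  have "compactin (product_topology (\<lambda>_. euclidean) UNIV) S"
    unfolding S_def compactin_PiE by simp
  then have "compact S" by (simp add: euclidean_product_topology)
  moreover have "eventually (\<lambda>f. f \<in> S) (filtermap (\<lambda>i. cdual_apply (g i)) F)"
    by (auto simp: eventually_filtermap S_def bound PiE_UNIV_domain)
  moreover have "filtermap (\<lambda>i. cdual_apply (g i)) F \<noteq> bot"
    using \<open>F \<noteq> bot\<close> by (simp add: filtermap_bot_iff)
  ultimately obtain \<phi> where ne: "inf (nhds \<phi>) (filtermap (\<lambda>i. cdual_apply (g i)) F) \<noteq> bot"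
    unfolding compact_filter by blast
  define F' where "F' = inf F (filtercomap (\<lambda>i. cdual_apply (g i)) (nhds \<phi>))"
  have "F' \<noteq> bot"
  proof
    assume "F' = bot"
    then obtain P Q where P: "eventually P F" and Q: "eventually Q (nhds \<phi>)"
      and PQ: "\<And>i. P i \<Longrightarrow> Q (cdual_apply (g i)) \<Longrightarrow> False"
      unfolding F'_def trivial_limit_def eventually_inf eventually_filtercomap by blast
    have "eventually (\<lambda>f. \<not> Q f) (filtermap (\<lambda>i. cdual_apply (g i)) F)"
      unfolding eventually_filtermap by (rule eventually_mono[OF P]) (use PQ in blast)
    with Q ne show False unfolding trivial_limit_def eventually_inf by blast
  qed
  have "filterlim (\<lambda>i. cdual_apply (g i)) (nhds \<phi>) F'"
    unfolding filterlim_iff_le_filtercomap F'_def by simp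
  then have lim: "((\<lambda>i. cdual_apply (g i) x) \<longlongrightarrow> \<phi> x) F'" for x
    using continuous_on_tendsto_compose[OF continuous_on_product_coordinates[of x]] by simp
  have "bounded_clinear \<phi>"
  proof (rule bounded_clinearI)
    show "\<phi> (x + y) = \<phi> x + \<phi> y" for x y
      by (rule tendsto_unique[OF \<open>F' \<noteq> bot\<close> lim])
        (simp add: bounded_clinear_simps[OF bounded_clinear_cdual_apply] tendsto_add[OF lim lim])
    show "\<phi> (c *\<^sub>C x) = c *\<^sub>C \<phi> x" for c x
      by (rule tendsto_unique[OF \<open>F' \<noteq> bot\<close> lim])
        (simp add: bounded_clinear_simps[OF bounded_clinear_cdual_apply] scaleC_complex_def
          tendsto_mult_left[OF lim])
    show "norm (\<phi> x) \<le> norm x * K" for x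
      by (rule tendsto_upperbound[OF tendsto_norm[OF lim] _ \<open>F' \<noteq> bot\<close>]) (simp add: bound)
  qed
  with that[of F' "cdual_of \<phi>"] \<open>F' \<noteq> bot\<close> lim show ?thesis
    by (simp add: F'_def cdual_apply_cdual_of)
qed


section \<open>Virtual diagonals\<close>

text \<open>An element \<open>M\<close> of the bidual of the projective tensor square with \<open>M \<cdot> a = a \<cdot> M\<close> and
  \<open>\<pi>\<^sup>*\<^sup>* M \<cdot> a = a\<close>, both spelled out on functionals. The identity \<open>a \<cdot> \<pi>\<^sup>*\<^sup>* M = a\<close> follows.\<close>

definition virtual_diagonal :: "('a::complex_banach_algebra, 'a) ptensor cdual cdual \<Rightarrow> bool"
  where "virtual_diagonal M \<longleftrightarrow>
    (\<forall>a f. cdual_apply M (dual_left ptensor_right a f) = cdual_apply M (dual_right ptensor_left f a)) \<and>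
    (\<forall>a f. cdual_apply M (banach_adjoint diagonal_op (dual_left (\<lambda>x b. x * b) a f)) = cdual_apply f a)"

lemma ptensor_dual_apply:
  "cdual_apply (dual_left ptensor_right a f) t = cdual_apply f (ptensor_right t a)"
  "cdual_apply (dual_right ptensor_left f a) t = cdual_apply f (ptensor_left a t)"
  by (simp_all add: banach_bimodule.dual_left_apply[OF ptensor_bimodule]
      banach_bimodule.dual_right_apply[OF ptensor_bimodule])

lemma algebra_dual_apply:
  fixes a :: "'a::complex_banach_algebra"
  shows "cdual_apply (dual_left (\<lambda>x b. x * b) a f) x = cdual_apply f (x * a)"
    "cdual_apply (dual_right (\<lambda>b x. b * x) f a) x = cdual_apply f (a * x)"
  by (simp_all add: banach_bimodule.dual_left_apply[OF algebra_bimodule]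
      banach_bimodule.dual_right_apply[OF algebra_bimodule])

lemma cdual_apply_adjoint_diagonal:
  "cdual_apply (banach_adjoint diagonal_op f) (a \<otimes>\<^sub>p b) = cdual_apply f (a * b)"
  by (simp add: cdual_apply_banach_adjoint[OF bounded_clinear_diagonal_op] diagonal_op_tensor)

lemma adjoint_diagonal_module_map:
  "banach_adjoint diagonal_op (dual_left (\<lambda>x b. x * b) a f)
    = dual_left ptensor_right a (banach_adjoint diagonal_op f)"
  "banach_adjoint diagonal_op (dual_right (\<lambda>b x. b * x) f a)
    = dual_right ptensor_left (banach_adjoint diagonal_op f) a"
  by (auto intro!: cdual_ptensor_eqI simp: cdual_apply_adjoint_diagonal algebra_dual_apply
      ptensor_dual_apply ptensor_left_tensor ptensor_right_tensor mult.assoc)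

lemma virtual_diagonal_right_identity:
  assumes "virtual_diagonal M"
  shows "cdual_apply M (banach_adjoint diagonal_op (dual_right (\<lambda>b x. b * x) f a)) = cdual_apply f a"
  using assms by (metis virtual_diagonal_def adjoint_diagonal_module_map)

lemma sigma_biflat_virtual_diagonal:
  fixes \<sigma> :: "'a::complex_banach_algebra \<Rightarrow> 'a" and e :: "'i \<Rightarrow> 'a"
  assumes bai: "bounded_approximate_identity e F" and \<sigma>: "bounded_clinear \<sigma>"
    and mult: "\<And>a b. \<sigma> (a * b) = \<sigma> a * \<sigma> b"
    and "sigma_biflat \<sigma>" and dense: "closure (range \<sigma>) = UNIV"
  shows "\<exists>M :: ('a, 'a) ptensor cdual cdual. virtual_diagonal M"
proof -
  obtain \<rho> :: "('a, 'a) ptensor cdual \<Rightarrow> 'a cdual" where \<rho>: "bounded_clinear \<rho>"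
    and left: "\<And>a f. \<rho> (dual_left ptensor_right (\<sigma> a) f) = dual_left (\<lambda>x b. x * b) a (\<rho> f)"
    and right: "\<And>a f. \<rho> (dual_right ptensor_left f (\<sigma> a)) = dual_right (\<lambda>b x. b * x) (\<rho> f) a"
    and "\<rho> \<circ> banach_adjoint diagonal_op = banach_adjoint \<sigma>"
    using \<open>sigma_biflat \<sigma>\<close> unfolding sigma_biflat_def by blast
  then have diag: "cdual_apply (\<rho> (banach_adjoint diagonal_op f)) a = cdual_apply f (\<sigma> a)" for f a
    using cdual_apply_banach_adjoint[OF \<sigma>, of f a] by (metis comp_apply)
  define B where "B a f = cdual_apply (\<rho> f) a" for a f
  have B: "bounded_cbilinear B"
  proof -
    have "bounded_cbilinear (\<lambda>f a. B a f)"
      unfolding B_def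
      using bounded_cbilinear_compose_args[OF bounded_cbilinear_cdual_apply \<rho>, of "\<lambda>a. a"]
      by (simp add: bounded_clinear_def bounded_linear_ident)
    then show ?thesis using bounded_bilinear.flip unfolding bounded_cbilinear_def by blast
  qed
  have F: "F \<noteq> bot" "bounded (range e)" "\<And>a. ((\<lambda>i. e i * a) \<longlongrightarrow> a) F" "\<And>a. ((\<lambda>i. a * e i) \<longlongrightarrow> a) F"
    using bai by (auto simp: bounded_approximate_identity_def)
  have "bounded ((\<lambda>a. cdual_of (B a)) ` range e)"
    using bounded_linear_image[OF F(2)] bounded_clinear_cdual_of[OF B]
    by (auto simp: bounded_clinear_def)
  then have "bounded (range (\<lambda>i. cdual_of (B (e i))))" by (simp add: image_image)
  from banach_alaoglu_subnet[OF F(1) this] obtain F' M where F': "F' \<le> F" "F' \<noteq> bot"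
    and "\<And>f. ((\<lambda>i. cdual_apply (cdual_of (B (e i))) f) \<longlongrightarrow> cdual_apply M f) F'"
    by metis
  then have M: "((\<lambda>i. cdual_apply (\<rho> f) (e i)) \<longlongrightarrow> cdual_apply M f) F'" for f
    by (simp add: cdual_apply_cdual_of_bilinear[OF B] B_def)
  have e: "((\<lambda>i. cdual_apply f (e i * a)) \<longlongrightarrow> cdual_apply f a) F'"
    "((\<lambda>i. cdual_apply f (a * e i)) \<longlongrightarrow> cdual_apply f a) F'" for f a
    using bounded_linear.tendsto[OF _ tendsto_mono[OF F'(1) F(3)]]
      bounded_linear.tendsto[OF _ tendsto_mono[OF F'(1) F(4)]] bounded_clinear_cdual_apply[of f]
    by (auto simp only: bounded_clinear_def)
  note unique = tendsto_unique[OF F'(2) M]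
  interpret T: banach_bimodule "dual_left ptensor_right"
    "dual_right (ptensor_left :: 'a \<Rightarrow> ('a, 'a) ptensor \<Rightarrow> _)"
    by (rule banach_bimodule.dual_bimodule[OF ptensor_bimodule])
  interpret A: banach_bimodule "dual_left (\<lambda>x b. x * b)" "dual_right (\<lambda>(b::'a) x. b * x)"
    by (rule banach_bimodule.dual_bimodule[OF algebra_bimodule])
  have "cdual_apply M (dual_left ptensor_right a f) = cdual_apply M (dual_right ptensor_left f a)" for a f
  proof (rule bounded_clinear_eq_if_dense[OF _ _ dense])
    show "bounded_clinear (\<lambda>a. cdual_apply M (dual_left ptensor_right a f))"
      by (rule bounded_clinear_compose[OF bounded_clinear_cdual_apply
            bounded_cbilinear_left[OF T.bounded_left]])
    show "bounded_clinear (\<lambda>a. cdual_apply M (dual_right ptensor_left f a))"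
      by (rule bounded_clinear_compose[OF bounded_clinear_cdual_apply
            bounded_cbilinear_right[OF T.bounded_right]])
    fix b assume "b \<in> range \<sigma>"
    then obtain a where b: "b = \<sigma> a" by blast
    have "cdual_apply M (dual_left ptensor_right b f) = cdual_apply (\<rho> f) a"
      by (rule unique) (simp add: b left algebra_dual_apply e)
    moreover have "cdual_apply M (dual_right ptensor_left f b) = cdual_apply (\<rho> f) a"
      by (rule unique) (simp add: b right algebra_dual_apply e)
    ultimately show "cdual_apply M (dual_left ptensor_right b f)
      = cdual_apply M (dual_right ptensor_left f b)" by simp
  qed
  moreover have "cdual_apply M (banach_adjoint diagonal_op (dual_left (\<lambda>x b. x * b) a f)) = cdual_apply f a"
    for a and f :: "'a cdual"
  proof (rule bounded_clinear_eq_if_dense[OF _ bounded_clinear_cdual_apply dense])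
    show "bounded_clinear (\<lambda>a. cdual_apply M (banach_adjoint diagonal_op (dual_left (\<lambda>x b. x * b) a f)))"
      by (rule bounded_clinear_compose[OF bounded_clinear_cdual_apply
            bounded_clinear_compose[OF bounded_clinear_banach_adjoint[OF bounded_clinear_diagonal_op]
              bounded_cbilinear_left[OF A.bounded_left]]])
    fix b assume "b \<in> range \<sigma>"
    then obtain a where b: "b = \<sigma> a" by blast
    have "((\<lambda>i. cdual_apply f (\<sigma> (e i * a))) \<longlongrightarrow> cdual_apply f (\<sigma> a)) F'"
      using e(1)[of "banach_adjoint \<sigma> f" a] by (simp add: cdual_apply_banach_adjoint[OF \<sigma>])
    then show "cdual_apply M (banach_adjoint diagonal_op (dual_left (\<lambda>x b. x * b) b f)) = cdual_apply f b"
      by (intro unique) (simp add: b diag algebra_dual_apply mult)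
  qed
  ultimately show ?thesis unfolding virtual_diagonal_def by blast
qed


section \<open>Derivations into dual bimodules\<close>

text \<open>The proof is written with the mean \<open>E = \<pi>\<^sup>*\<^sup>* M\<close>, which satisfies
  \<open>E (c \<cdot> g) = g c = E (g \<cdot> c)\<close>. It defines a projection \<open>P\<close> on \<open>X\<^sup>*\<close>, where \<open>\<langle>P f, x\<rangle>\<close> is the mean of
  \<open>a \<mapsto> \<langle>f, x \<cdot> a\<rangle>\<close>. The functional \<open>\<phi>\<close> implements \<open>P \<circ> D\<close>, and \<open>- \<psi>\<close> implements \<open>D - P \<circ> D\<close>.\<close>

lemma derivation_inner_if_virtual_diagonal:
  fixes l :: "'a::complex_banach_algebra \<Rightarrow> 'x::complex_banach \<Rightarrow> 'x" and D :: "'a \<Rightarrow> 'x cdual"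
    and M :: "('a, 'a) ptensor cdual cdual"
  assumes M: "virtual_diagonal M" and "banach_bimodule l r" and D: "bounded_clinear D"
    and deriv: "\<And>a b. D (a * b) = dual_left r a (D b) + dual_right l (D a) b"
  shows "\<exists>\<theta>. \<forall>c. D c = dual_left r c \<theta> - dual_right l \<theta> c"
proof -
  interpret banach_bimodule l r by fact
  define E where "E g = cdual_apply M (banach_adjoint diagonal_op g)" for g
  have E: "bounded_clinear E"
    unfolding E_def
    by (rule bounded_clinear_compose[OF bounded_clinear_cdual_apply
          bounded_clinear_banach_adjoint[OF bounded_clinear_diagonal_op]])
  have E_left: "E (dual_left (\<lambda>x b. x * b) c g) = cdual_apply g c" for c g
    using M by (simp add: E_def virtual_diagonal_def)
  have E_right: "E (dual_right (\<lambda>b x. b * x) g c) = cdual_apply g c" for c g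
    by (simp add: E_def virtual_diagonal_right_identity[OF M])
  obtain R where R: "0 \<le> R" "\<And>x a. norm (r x a) \<le> norm x * norm a * R"
    by (rule bounded_cbilinear_bound[OF bounded_right]) blast
  obtain K where K: "0 \<le> K" "\<And>a. norm (D a) \<le> norm a * K" by (rule bounded_clinear_bound[OF D]) blast
  note simps = bounded_cbilinear_simps[OF bounded_right] cdual_apply_add cdual_apply_diff
    cdual_apply_scaleC scaleC_complex_def bounded_clinear_simps[OF bounded_clinear_cdual_apply]
    bounded_clinear_simps[OF D]

  \<comment> \<open>the coefficient functional \<open>a \<mapsto> \<langle>f, x \<cdot> a\<rangle>\<close> on the algebra\<close>
  define C where "C f x = cdual_of (\<lambda>a. cdual_apply f (r x a))" for f x
  have C_apply: "cdual_apply (C f x) a = cdual_apply f (r x a)" for f x a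
    unfolding C_def
    by (simp add: cdual_apply_cdual_of bounded_clinear_compose[OF bounded_clinear_cdual_apply
          bounded_cbilinear_right[OF bounded_right]])
  have C: "bounded_cbilinear C"
  proof (rule bounded_cbilinearI)
    fix f x
    show "norm (C f x) \<le> norm f * norm x * R"
    proof (rule cdual_norm_bound)
      show "cmod (cdual_apply (C f x) a) \<le> norm f * norm x * R * norm a" for a
        using order_trans[OF cdual_apply_norm mult_left_mono[OF R(2)[of x a] norm_ge_zero[of f]]]
        by (simp add: C_apply mult_ac)
    qed (use R(1) in simp)
  qed (auto intro!: cdual_eqI simp: C_apply simps)
  \<comment> \<open>\<open>Q f\<close> stands for \<open>f - P f\<close>, as a function on \<open>X\<close>\<close>
  define Q where "Q f x = cdual_apply f x - E (C f x)" for f x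
  have Q: "bounded_cbilinear Q"
  proof -
    have EC: "bounded_cbilinear (\<lambda>f x. E (C f x))" by (rule bounded_clinear_compose_bilinear[OF E C])
    obtain L where L: "0 \<le> L" "\<And>f x. norm (E (C f x)) \<le> norm f * norm x * L"
      by (rule bounded_cbilinear_bound[OF EC]) blast
    show ?thesis
    proof (rule bounded_cbilinearI)
      show "norm (Q f x) \<le> norm f * norm x * (1 + L)" for f x
        using norm_triangle_ineq4[of "cdual_apply f x" "E (C f x)"] cdual_apply_norm[of f x] L(2)[of f x]
        by (simp add: Q_def distrib_left)
    qed (simp_all add: Q_def simps bounded_cbilinear_simps[OF EC] algebra_simps)
  qed
  have Q_left: "Q (dual_left r a f) x = 0" for a f x
  proof -
    have "C (dual_left r a f) x = dual_left (\<lambda>x b. x * b) a (C f x)"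
      by (rule cdual_eqI) (simp add: C_apply dual_left_apply algebra_dual_apply right_assoc)
    then show ?thesis by (simp add: Q_def E_left C_apply dual_left_apply)
  qed
  have Q_right: "Q (dual_right l f c) x = Q f (l c x)" for c f x
  proof -
    have "C (dual_right l f c) x = C f (l c x)"
      by (rule cdual_eqI) (simp add: C_apply dual_right_apply left_right)
    then show ?thesis by (simp add: Q_def dual_right_apply)
  qed
  have Q_zero: "Q f (r x c) = 0" for f x c
  proof -
    have "C f (r x c) = dual_right (\<lambda>b x. b * x) (C f x) c"
      by (rule cdual_eqI) (simp add: C_apply algebra_dual_apply right_assoc)
    then show ?thesis by (simp add: Q_def E_right C_apply)
  qed

  \<comment> \<open>\<open>\<psi>\<close> is the mean of the component \<open>D - P \<circ> D\<close>, on whose values \<open>A\<close> acts trivially from the left\<close>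
  have QD: "bounded_cbilinear (\<lambda>x a. Q (D a) x)"
  proof -
    have "bounded_cbilinear (\<lambda>a x. Q (D a) x)"
      using bounded_cbilinear_compose_args[OF Q D, of "\<lambda>x. x"]
      by (simp add: bounded_clinear_def bounded_linear_ident)
    then show ?thesis using bounded_bilinear.flip unfolding bounded_cbilinear_def by blast
  qed
  define H where "H x = cdual_of (\<lambda>a. Q (D a) x)" for x
  have H_apply: "cdual_apply (H x) a = Q (D a) x" for x a
    unfolding H_def by (rule cdual_apply_cdual_of_bilinear[OF QD])
  define \<psi> where "\<psi> = cdual_of (\<lambda>x. E (H x))"
  have \<psi>_apply: "cdual_apply \<psi> x = E (H x)" for x
    unfolding \<psi>_def H_def
    by (simp add: cdual_apply_cdual_of bounded_clinear_compose[OF E bounded_clinear_cdual_of[OF QD]])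
  have \<psi>_right: "cdual_apply \<psi> (r x c) = 0" for x c
  proof -
    have "H (r x c) = 0"
      by (rule cdual_eqI)
        (use bounded_clinear_zero[OF bounded_cbilinear_left[OF bounded_cbilinear_cdual_apply]]
          in \<open>simp add: H_apply Q_zero\<close>)
    then show ?thesis by (simp add: \<psi>_apply bounded_clinear_zero[OF E])
  qed
  have \<psi>_left: "cdual_apply \<psi> (l c x) = Q (D c) x" for x c
  proof -
    have "H (l c x) = dual_left (\<lambda>x b. x * b) c (H x)"
      by (rule cdual_eqI)
        (simp add: H_apply algebra_dual_apply deriv bounded_cbilinear_simps[OF Q] Q_left Q_right)
    then show ?thesis by (simp add: \<psi>_apply E_left H_apply)
  qed

  \<comment> \<open>the functional on the tensor square that sends \<open>a \<otimes> b\<close> to \<open>\<langle>a \<cdot> D b, x\<rangle>\<close>\<close>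
  define T where "T x a b = cdual_apply (D b) (r x a)" for x a b
  have T_bound: "norm (T x a b) \<le> norm a * norm b * (norm x * (R * K))" for x a b
  proof -
    have "norm (T x a b) \<le> norm (D b) * norm (r x a)"
      unfolding T_def by (rule cdual_apply_norm)
    also have "\<dots> \<le> (norm b * K) * (norm x * norm a * R)"
      using K R by (intro mult_mono) auto
    finally show ?thesis by (simp add: mult_ac)
  qed
  have T: "bounded_cbilinear (T x)" for x
  proof (rule bounded_cbilinearI)
    show "norm (T x a b) \<le> norm a * norm b * (norm x * (R * K))" for a b by (rule T_bound)
  qed (simp_all add: T_def simps)
  define \<Lambda> where "\<Lambda> x = cdual_of (ptensor_lift (T x))" for x
  have \<Lambda>: "bounded_clinear \<Lambda>"
    unfolding \<Lambda>_def
    by (rule bounded_clinear_cdual_of[OF bounded_cbilinear_ptensor_lift[OF T _ _ T_bound]])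
      (use K(1) R(1) in \<open>simp_all add: T_def simps\<close>)
  have \<Lambda>_tensor: "cdual_apply (\<Lambda> x) (a \<otimes>\<^sub>p b) = cdual_apply (D b) (r x a)" for x a b
    by (simp add: \<Lambda>_def cdual_apply_cdual_of bounded_clinear_ptensor_lift[OF T]
        ptensor_lift_tensor[OF T] T_def)
  define \<phi> where "\<phi> = banach_adjoint \<Lambda> M"
  have \<phi>: "cdual_apply \<phi> (r x c) = E (C (D c) x) + cdual_apply \<phi> (l c x)" for x c
  proof -
    have "\<Lambda> (r x c) = dual_right ptensor_left (\<Lambda> x) c"
      by (rule cdual_ptensor_eqI)
        (simp add: \<Lambda>_tensor ptensor_dual_apply ptensor_left_tensor right_assoc)
    then have "cdual_apply \<phi> (r x c) = cdual_apply M (dual_left ptensor_right c (\<Lambda> x))"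
      using M by (simp add: \<phi>_def cdual_apply_banach_adjoint[OF \<Lambda>] virtual_diagonal_def)
    also have "dual_left ptensor_right c (\<Lambda> x) = banach_adjoint diagonal_op (C (D c) x) + \<Lambda> (l c x)"
      by (rule cdual_ptensor_eqI)
        (simp add: \<Lambda>_tensor ptensor_dual_apply ptensor_right_tensor cdual_apply_adjoint_diagonal
          cdual_apply_add deriv dual_left_apply dual_right_apply C_apply right_assoc left_right)
    finally show ?thesis
      by (simp add: E_def \<phi>_def cdual_apply_banach_adjoint[OF \<Lambda>] simps)
  qed

  have "D c = dual_left r c (\<phi> - \<psi>) - dual_right l (\<phi> - \<psi>) c" for c
    by (rule cdual_eqI)
      (simp add: cdual_apply_diff dual_left_apply dual_right_apply \<phi> \<psi>_right \<psi>_left Q_def)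
  then show ?thesis by blast
qed

lemma amenable_if_virtual_diagonal:
  fixes M :: "('a::complex_banach_algebra, 'a) ptensor cdual cdual"
  assumes "virtual_diagonal M"
  shows "amenable TYPE('x::complex_banach) TYPE('a)"
  unfolding amenable_def sigma_amenable_def sigma_derivation_def sigma_inner_def
  using derivation_inner_if_virtual_diagonal[OF assms] by auto

lemma sigma_amenable_if_amenable:
  fixes \<sigma> :: "'a::complex_banach_algebra \<Rightarrow> 'a"
  assumes amenable: "amenable TYPE('x::complex_banach) TYPE('a)" and \<sigma>: "bounded_clinear \<sigma>"
    and mult: "\<And>a b. \<sigma> (a * b) = \<sigma> a * \<sigma> b"
  shows "sigma_amenable TYPE('x) \<sigma>"
  unfolding sigma_amenable_def
proof (intro allI impI)
  fix l :: "'a \<Rightarrow> 'x \<Rightarrow> 'x" and r D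
  assume "banach_bimodule l r" and D: "sigma_derivation \<sigma> (dual_left r) (dual_right l) D"
  then interpret banach_bimodule l r by simp
  have id: "bounded_clinear (\<lambda>x::'x. x)" by (simp add: bounded_clinear_def bounded_linear_ident)
  have "banach_bimodule (\<lambda>a. l (\<sigma> a)) (\<lambda>x a. r x (\<sigma> a))"
    by unfold_locales
      (simp_all add: bounded_cbilinear_compose_args[OF bounded_left \<sigma> id]
        bounded_cbilinear_compose_args[OF bounded_right id \<sigma>] mult left_assoc right_assoc left_right)
  moreover have actions: "dual_left (\<lambda>x a. r x (\<sigma> a)) a f = dual_left r (\<sigma> a) f"
    "dual_right (\<lambda>a. l (\<sigma> a)) f a = dual_right l f (\<sigma> a)" for a f
    by (simp_all add: dual_left_def dual_right_def)
  then have "sigma_derivation id (dual_left (\<lambda>x a. r x (\<sigma> a))) (dual_right (\<lambda>a. l (\<sigma> a))) D"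
    using D by (simp add: sigma_derivation_def)
  ultimately have "sigma_inner id (dual_left (\<lambda>x a. r x (\<sigma> a))) (dual_right (\<lambda>a. l (\<sigma> a))) D"
    using amenable unfolding amenable_def sigma_amenable_def by blast
  then show "sigma_inner \<sigma> (dual_left r) (dual_right l) D"
    by (simp add: sigma_inner_def actions)
qed

theorem proposition3p3:
  fixes \<sigma> :: "'a::complex_banach_algebra \<Rightarrow> 'a"
    and e :: "'i \<Rightarrow> 'a" and F :: "'i filter"
  assumes "bounded_approximate_identity e F"
    and "\<sigma> \<in> algebra_endomorphisms"
    and "sigma_biflat \<sigma>"
    and "closure (range \<sigma>) = UNIV"
  shows "amenable TYPE('x::complex_banach) TYPE('a) \<and> sigma_amenable TYPE('x) \<sigma>"
proof -
  have \<sigma>: "bounded_clinear \<sigma>" and mult: "\<And>a b. \<sigma> (a * b) = \<sigma> a * \<sigma> b"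
    using assms(2) by (auto simp: algebra_endomorphisms_def intro: continuous_clinear_imp_bounded)
  obtain M :: "('a, 'a) ptensor cdual cdual" where "virtual_diagonal M"
    using sigma_biflat_virtual_diagonal[OF assms(1) \<sigma> mult assms(3,4)] by blast
  then have "amenable TYPE('x) TYPE('a)" by (rule amenable_if_virtual_diagonal)
  with sigma_amenable_if_amenable[OF this \<sigma> mult] show ?thesis by blast
qed

end
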